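(* Let $0<q<1$ and $a>0$. Let $\mathfrak{l}^2$ be the Hilbert space of complex functions on the set $\{0,1,2,\dots\}$ with the scalar product $$\langle f_1,f_2\rangle=\sum_{m=0}^\infty \frac{(1+aq^{2m})\,a^m}{(-aq^m;q)_\infty\,(q;q)_m}\,q^{m(3m-1)/2}\,f_1(m)\,\overline{f_2(m)}.$$ Then the functions $m\mapsto d_n(\mu(m);a;q)$, $n=0,1,2,\dots$, where $\mu(m)=q^{-m}-aq^m$ and $d_n$ are the dual alternative $q$-Charlier polynomials, form an orthogonal basis of $\mathfrak{l}^2$. That is, the dual alternative $q$-Charlier polynomials form a complete system in the $L^2$-space with respect to the point measure having mass $\frac{(1+aq^{2m})a^m}{(-aq^m;q)_\infty(q;q)_m}q^{m(3m-1)/2}$ at $\mu(m)$, $m=0,1,2,\dots$ (in other words, this point measure is an extremal orthogonality measure for these polynomials).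
   Context: Notation: $(x;q)_k=\prod_{j=0}^{k-1}(1-xq^j)$ and $(x;q)_\infty=\prod_{j=0}^{\infty}(1-xq^j)$. The dual alternative $q$-Charlier polynomials are the polynomials of degree $n$ in $\mu(m):=q^{-m}-a\,q^{m}$ given by $$d_n(\mu(m);a;q):={}_3\phi_0\bigl(q^{-m},-a\,q^{m},q^{-n};\,-\,;\,q,-q^n/a\bigr)=\sum_{k=0}^{n}\frac{(q^{-m};q)_k(-aq^m;q)_k(q^{-n};q)_k}{(q;q)_k}\,q^{-k(k-1)}\,(-q^n/a)^k .$$ An orthogonality measure is called extremal if the polynomials are dense in the corresponding $L^2$-space. *)

theory Defs
  imports "HOL-Analysis.Analysis" "HOL-Computational_Algebra.Computational_Algebra"
begin

definition qpoch :: "real \<Rightarrow> real \<Rightarrow> nat \<Rightarrow> real" where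
  "qpoch x q k = (\<Prod>j<k. 1 - x * q ^ j)"

definition qpoch_inf :: "real \<Rightarrow> real \<Rightarrow> real" where
  "qpoch_inf x q = prodinf (\<lambda>j. 1 - x * q ^ j)"

definition mu :: "real \<Rightarrow> real \<Rightarrow> nat \<Rightarrow> real" where
  "mu a q m = q powi (- int m) - a * q ^ m"

definition dual_charlier_sum :: "nat \<Rightarrow> real \<Rightarrow> real \<Rightarrow> nat \<Rightarrow> real" where
  "dual_charlier_sum n a q m =
     (\<Sum>k\<le>n. qpoch (q powi (- int m)) q k * qpoch (- a * q ^ m) q k * qpoch (q powi (- int n)) q k
              / qpoch q q k * q powi (- (int k * (int k - 1))) * (- (q ^ n) / a) ^ k)"

text \<open>The polynomial in \<open>\<mu>(m)\<close> given by the \<open>\<^sub>3\<phi>\<^sub>0\<close> sum. It exists and is unique for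
  \<open>0 < q < 1\<close>, \<open>a > 0\<close>: see \<open>ex1_dual_charlier\<close> below.\<close>

definition dual_charlier :: "nat \<Rightarrow> real \<Rightarrow> real \<Rightarrow> real poly" where
  "dual_charlier n a q =
     (THE p. degree p = n \<and> (\<forall>m. poly p (mu a q m) = dual_charlier_sum n a q m))"

lemma qpoch_mu_factor:
  assumes "0 < q"
  shows "qpoch (q powi (- int m)) q k * qpoch (- a * q ^ m) q k
       = (\<Prod>j<k. poly [:1 - a * q ^ (2 * j), - (q ^ j):] (mu a q m))"
proof -
  have *: "q powi (- int m) * q ^ m = 1"
    using assms by (simp add: power_int_minus)
  have "(1 - q powi (- int m) * q ^ j) * (1 - (- a * q ^ m) * q ^ j)
        = poly [:1 - a * q ^ (2 * j), - (q ^ j):] (mu a q m)" for j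
  proof -
    have "(1 - q powi (- int m) * q ^ j) * (1 - (- a * q ^ m) * q ^ j)
        = 1 - mu a q m * q ^ j - a * (q powi (- int m) * q ^ m) * (q ^ j * q ^ j)"
      by (simp add: mu_def algebra_simps)
    also have "\<dots> = 1 - mu a q m * q ^ j - a * q ^ (2 * j)"
      unfolding * by (simp add: power_add [symmetric] mult_2)
    finally show ?thesis by (simp add: algebra_simps)
  qed
  then show ?thesis
    by (simp add: qpoch_def prod.distrib [symmetric])
qed

lemma inj_mu:
  assumes "0 < q" "q < 1" "0 < a"
  shows "inj (mu a q)"
proof -
  have "strict_mono (mu a q)"
    unfolding strict_mono_Suc_iff
  proof
    fix m
    have "q ^ Suc m < q ^ m" using assms by simp
    moreover from this have "inverse (q ^ m) < inverse (q ^ Suc m)"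
      using assms by (intro less_imp_inverse_less) auto
    moreover have "a * q ^ Suc m < a * q ^ m"
      using assms calculation(1) by (intro mult_strict_left_mono)
    ultimately show "mu a q m < mu a q (Suc m)"
      unfolding mu_def power_int_minus power_int_of_nat by linarith
  qed
  then show ?thesis by (rule strict_mono_imp_inj_on)
qed

lemma ex1_dual_charlier:
  assumes "0 < q" "q < 1" "0 < a"
  shows "\<exists>!p. degree p = n \<and> (\<forall>m. poly p (mu a q m) = dual_charlier_sum n a q m)"
proof -
  define c where "c k = qpoch (q powi (- int n)) q k / qpoch q q k
      * q powi (- (int k * (int k - 1))) * (- (q ^ n) / a) ^ k" for k
  define r where "r k = (\<Prod>j<k. [:1 - a * q ^ (2 * j), - (q ^ j):])" for k
  define p where "p = (\<Sum>k\<le>n. smult (c k) (r k))"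
  have deg_r: "degree (r k) = k" for k
    unfolding r_def using assms by (subst degree_prod_eq_sum_degree) auto
  have "qpoch q q n \<noteq> 0"
  proof -
    have "q * q ^ j < 1" for j
      using assms power_Suc_less_one [of q j] by simp
    then show ?thesis by (auto simp: qpoch_def)
      (metis less_irrefl)
  qed
  moreover have "qpoch (q powi (- int n)) q n \<noteq> 0"
  proof -
    have "q powi (- int n) * q ^ j \<noteq> 1" if "j < n" for j
    proof
      assume "q powi (- int n) * q ^ j = 1"
      then have "q ^ j = q ^ n" using assms by (simp add: power_int_minus field_simps)
      moreover have "q ^ n < q ^ j" using assms that by (intro power_strict_decreasing)
      ultimately show False by simp
    qed
    then show ?thesis by (auto simp: qpoch_def)
  qed
  ultimately have c: "c n \<noteq> 0" using assms by (auto simp: c_def)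
  have deg: "degree p = n"
  proof (cases n)
    case 0
    then show ?thesis by (simp add: p_def r_def)
  next
    case (Suc l)
    have "degree (\<Sum>k\<le>l. smult (c k) (r k)) \<le> l"
      by (rule degree_sum_le) (auto intro: order_trans [OF degree_smult_le] simp: deg_r)
    then have "degree (\<Sum>k\<le>l. smult (c k) (r k)) < degree (smult (c n) (r n))"
      using c Suc by (simp add: deg_r)
    then have "degree ((\<Sum>k\<le>l. smult (c k) (r k)) + smult (c n) (r n)) = degree (smult (c n) (r n))"
      by (rule degree_add_eq_right)
    then show ?thesis using c Suc by (simp add: p_def deg_r)
  qed
  have val: "poly p (mu a q m) = dual_charlier_sum n a q m" for m
    unfolding p_def dual_charlier_sum_def poly_sum
    by (rule sum.cong [OF refl])
       (simp only: qpoch_mu_factor [OF assms(1)] poly_smult c_def r_def poly_prod, simp)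
  show ?thesis
  proof (rule ex1I [of _ p])
    fix p' assume p': "degree p' = n \<and> (\<forall>m. poly p' (mu a q m) = dual_charlier_sum n a q m)"
    have "range (mu a q) \<subseteq> {x. poly (p' - p) x = 0}" using p' val by auto
    moreover have "infinite (range (mu a q))"
      using inj_mu [OF assms] by (rule range_inj_infinite)
    ultimately have "infinite {x. poly (p' - p) x = 0}" using finite_subset by blast
    then have "p' - p = 0" using poly_roots_finite by blast
    then show "p' = p" by simp
  qed (use deg val in auto)
qed

lemma dual_charlier:
  assumes "0 < q" "q < 1" "0 < a"
  shows degree_dual_charlier: "degree (dual_charlier n a q) = n"
    and poly_dual_charlier: "poly (dual_charlier n a q) (mu a q m) = dual_charlier_sum n a q m"
  using theI' [OF ex1_dual_charlier [OF assms, of n]] unfolding dual_charlier_def by blast+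

text \<open>Below, \<open>w\<close> is meant to be a positive weight; the scalar product is linear in the first argument.\<close>

definition wl2 :: "(nat \<Rightarrow> real) \<Rightarrow> (nat \<Rightarrow> complex) set" where
  "wl2 w = {f. summable (\<lambda>m. w m * (cmod (f m))\<^sup>2)}"

definition wl2_inner :: "(nat \<Rightarrow> real) \<Rightarrow> (nat \<Rightarrow> complex) \<Rightarrow> (nat \<Rightarrow> complex) \<Rightarrow> complex" where
  "wl2_inner w f g = (\<Sum>m. of_real (w m) * f m * cnj (g m))"

definition wl2_norm :: "(nat \<Rightarrow> real) \<Rightarrow> (nat \<Rightarrow> complex) \<Rightarrow> real" where
  "wl2_norm w f = sqrt (Re (wl2_inner w f f))"

definition lin_combs :: "(nat \<Rightarrow> 'a \<Rightarrow> complex) \<Rightarrow> ('a \<Rightarrow> complex) set" where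
  "lin_combs e = {\<lambda>x. \<Sum>n<N. c n * e n x | N c. True}"

definition orthogonal_basis :: "(nat \<Rightarrow> real) \<Rightarrow> (nat \<Rightarrow> nat \<Rightarrow> complex) \<Rightarrow> bool" where
  "orthogonal_basis w e \<longleftrightarrow>
     (\<forall>n. e n \<in> wl2 w \<and> e n \<noteq> (\<lambda>_. 0)) \<and>
     (\<forall>i j. i \<noteq> j \<longrightarrow> wl2_inner w (e i) (e j) = 0) \<and>
     (\<forall>f\<in>wl2 w. \<forall>\<epsilon>>0. \<exists>g\<in>lin_combs e. wl2_norm w (\<lambda>m. f m - g m) < \<epsilon>)"

definition L2_space :: "'a measure \<Rightarrow> ('a \<Rightarrow> complex) set" where
  "L2_space M = {f \<in> borel_measurable M. integrable M (\<lambda>x. (cmod (f x))\<^sup>2)}"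

definition L2_dense :: "'a measure \<Rightarrow> ('a \<Rightarrow> complex) set \<Rightarrow> bool" where
  "L2_dense M S \<longleftrightarrow> S \<subseteq> L2_space M \<and>
     (\<forall>f\<in>L2_space M. \<forall>\<epsilon>>0. \<exists>g\<in>S. sqrt (\<integral>x. (cmod (f x - g x))\<^sup>2 \<partial>M) < \<epsilon>)"

definition orthogonality_measure :: "real measure \<Rightarrow> (nat \<Rightarrow> real poly) \<Rightarrow> bool" where
  "orthogonality_measure M p \<longleftrightarrow>
     sets M = sets borel \<and>
     (\<forall>k. integrable M (\<lambda>x. x ^ k)) \<and>
     (\<forall>i j. i \<noteq> j \<longrightarrow> (\<integral>x. poly (p i) x * poly (p j) x \<partial>M) = 0) \<and>
     (\<forall>n. (\<integral>x. (poly (p n) x)\<^sup>2 \<partial>M) > 0)"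

definition extremal_orthogonality_measure :: "real measure \<Rightarrow> (nat \<Rightarrow> real poly) \<Rightarrow> bool" where
  "extremal_orthogonality_measure M p \<longleftrightarrow>
     orthogonality_measure M p \<and> L2_dense M (range (\<lambda>(r :: complex poly) x. poly r (of_real x)))"

text \<open>The exponent \<open>m(3m-1)/2\<close> is a natural number: \<open>m(3m-1)\<close> is always even, and the truncated
  subtraction only occurs for \<open>m = 0\<close>, where the product vanishes anyway.\<close>

definition weight :: "real \<Rightarrow> real \<Rightarrow> nat \<Rightarrow> real" where
  "weight a q m = (1 + a * q ^ (2 * m)) * a ^ m / (qpoch_inf (- a * q ^ m) q * qpoch q q m)
                    * q ^ (m * (3 * m - 1) div 2)"

definition point_mass_measure :: "real \<Rightarrow> real \<Rightarrow> real measure" where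
  "point_mass_measure a q =
     distr (point_measure UNIV (\<lambda>m. ennreal (weight a q m))) borel (mu a q)"

end

theory Submission
  imports Defs
begin

text \<open>For fixed \<open>m\<close>, the number \<open>d\<^sub>n(\<mu>(m))\<close> is the value at \<open>q\<^sup>n\<close> of a polynomial \<open>D\<^sub>m\<close> of degree \<open>m\<close>. Euler's
  series for \<open>(-z;q)\<^sub>\<infinity>\<close> and the \<open>q\<close>-Chu--Vandermonde sum show that the \<open>D\<^sub>m\<close> are orthogonal with respect
  to the masses \<open>\<rho>(n) = a\<^sup>n q\<^bsup>n(n+1)/2\<^esup> / (q;q)\<^sub>n\<close> at \<open>q\<^sup>n\<close>, and that the squared norm of \<open>D\<^sub>m\<close> is
  \<open>1 / w(m)\<close>, where \<open>w\<close> is the weight of the theorem. By the Weierstrass theorem they are complete, so the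
  matrix with entries \<open>(w(m) \<rho>(n))\<^bsup>1/2\<^esup> D\<^sub>m(q\<^sup>n)\<close> is orthogonal. Its columns are then orthonormal, which
  is the orthogonality of the \<open>d\<^sub>n\<close>, and they are complete because its rows have norm one.\<close>

section \<open>Orthogonal matrices with complete rows\<close>

text \<open>Expand the square: the delta and cross terms live at the single index \<open>k\<close>,
  and \<open>orth\<close> evaluates the quadratic term.\<close>

lemma weighted_residual:
  fixes A :: "nat \<Rightarrow> nat \<Rightarrow> real" and r u :: "nat \<Rightarrow> real"
  assumes orth: "\<And>i j. (\<lambda>n. r n * (A i n * A j n)) sums (if i = j then u i else 0)"
  shows "(\<lambda>n. r n * ((if n = k then 1 else 0) - (\<Sum>m<M. c m * A m n))\<^sup>2)
           sums (r k - 2 * r k * (\<Sum>m<M. c m * A m k) + (\<Sum>m<M. (c m)\<^sup>2 * u m))"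
proof -
  define S where "S n = (\<Sum>m<M. c m * A m n)" for n
  have 1: "(\<lambda>n. if n = k then r n else 0) sums r k"
    by (rule sums_single)
  have 2: "(\<lambda>n. if n = k then 2 * r n * S n else 0) sums (2 * r k * S k)"
    by (rule sums_single)
  have "(\<lambda>n. \<Sum>i<M. \<Sum>j<M. c i * c j * (r n * (A i n * A j n)))
          sums (\<Sum>i<M. \<Sum>j<M. c i * c j * (if i = j then u i else 0))"
    by (intro sums_sum sums_mult orth)
  also have "(\<lambda>n. \<Sum>i<M. \<Sum>j<M. c i * c j * (r n * (A i n * A j n))) = (\<lambda>n. r n * (S n)\<^sup>2)"
    by (simp add: S_def power2_eq_square sum_product sum_distrib_left algebra_simps)
  also have "(\<Sum>i<M. \<Sum>j<M. c i * c j * (if i = j then u i else 0)) = (\<Sum>m<M. (c m)\<^sup>2 * u m)"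
    by (simp add: if_distrib power2_eq_square cong: if_cong)
  finally have 3: "(\<lambda>n. r n * (S n)\<^sup>2) sums (\<Sum>m<M. (c m)\<^sup>2 * u m)" .
  have "(\<lambda>n. (if n = k then r n else 0) - (if n = k then 2 * r n * S n else 0) + r n * (S n)\<^sup>2)
     = (\<lambda>n. r n * ((if n = k then 1 else 0) - S n)\<^sup>2)"
    by (auto simp: power2_eq_square algebra_simps)
  with sums_add [OF sums_diff [OF 1 2] 3] show ?thesis
    by (simp add: S_def)
qed

text \<open>\<open>w m * r k * A m k\<close> is the Fourier coefficient of the delta at
  \<open>k\<close>: its scalar product \<open>r k * A m k\<close> with row \<open>m\<close>, divided
  by the squared norm \<open>1 / w m\<close>. The cross term is then twice the quadratic
  one.\<close>

lemma weighted_residual_fourier: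
  fixes A :: "nat \<Rightarrow> nat \<Rightarrow> real" and r w :: "nat \<Rightarrow> real"
  assumes w: "\<And>m. w m > 0"
    and orth: "\<And>i j. (\<lambda>n. r n * (A i n * A j n)) sums (if i = j then 1 / w i else 0)"
  shows "(\<lambda>n. r n * ((if n = k then 1 else 0) - (\<Sum>m<M. (w m * r k * A m k) * A m n))\<^sup>2)
           sums (r k - (r k)\<^sup>2 * (\<Sum>m<M. w m * (A m k)\<^sup>2))"
proof -
  have "r k - 2 * r k * (\<Sum>m<M. (w m * r k * A m k) * A m k) + (\<Sum>m<M. (w m * r k * A m k)\<^sup>2 * (1 / w m))
     = r k - (r k)\<^sup>2 * (\<Sum>m<M. w m * (A m k)\<^sup>2)"
  proof -
    have "(\<Sum>m<M. (w m * r k * A m k)\<^sup>2 * (1 / w m)) = (r k)\<^sup>2 * (\<Sum>m<M. w m * (A m k)\<^sup>2)"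
      unfolding sum_distrib_left using w
      by (intro sum.cong refl) (simp add: power2_eq_square less_imp_neq [symmetric])
    moreover have "r k * (\<Sum>m<M. (w m * r k * A m k) * A m k) = (r k)\<^sup>2 * (\<Sum>m<M. w m * (A m k)\<^sup>2)"
      unfolding sum_distrib_left
      by (intro sum.cong refl) (simp add: power2_eq_square)
    ultimately show ?thesis by simp
  qed
  with weighted_residual [OF orth, where c = "\<lambda>m. w m * r k * A m k" and k = k and M = M] show ?thesis
    by (simp only:)
qed

text \<open>The partial sums increase, Bessel's inequality bounds them by \<open>1 / r k\<close>, and the residual of an
  arbitrary linear combination bounds the residual of the Fourier sum from above.\<close>

lemma dual_orthogonality:
  fixes A :: "nat \<Rightarrow> nat \<Rightarrow> real" and r w :: "nat \<Rightarrow> real"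
  assumes r: "\<And>n. r n > 0" and w: "\<And>m. w m > 0"
    and orth: "\<And>i j. (\<lambda>n. r n * (A i n * A j n)) sums (if i = j then 1 / w i else 0)"
    and dense: "\<And>k \<epsilon>. \<epsilon> > 0 \<Longrightarrow> \<exists>M c. (\<Sum>n. r n * ((if n = k then 1 else 0) - (\<Sum>m<M. c m * A m n))\<^sup>2) < \<epsilon>"
  shows "(\<lambda>m. w m * (A m k * A m l)) sums (if k = l then 1 / r k else 0)"
proof -
  define R where "R M = r k - (r k)\<^sup>2 * (\<Sum>m<M. w m * (A m k)\<^sup>2)" for M
  have res: "(\<lambda>n. r n * ((if n = k then 1 else 0) - (\<Sum>m<M. (w m * r k * A m k) * A m n))\<^sup>2) sums R M" for M
    unfolding R_def by (rule weighted_residual_fourier [OF w orth])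
  have nonneg: "0 \<le> R M" for M
    using r by (intro sums_le [OF _ sums_zero res]) (simp add: less_imp_le)
  have anti: "R N \<le> R M" if "M \<le> N" for M N
    unfolding R_def using that w
    by (intro diff_left_mono mult_left_mono sum_mono2) (auto simp: less_imp_le)
  have lim: "R \<longlonglongrightarrow> 0"
  proof (rule LIMSEQ_I)
    fix \<epsilon> :: real assume "\<epsilon> > 0"
    then obtain M c where Mc: "(\<Sum>n. r n * ((if n = k then 1 else 0) - (\<Sum>m<M. c m * A m n))\<^sup>2) < \<epsilon>"
      using dense by blast
    have eq: "(\<Sum>n. r n * ((if n = k then 1 else 0) - (\<Sum>m<M. c m * A m n))\<^sup>2)
        = r k - 2 * r k * (\<Sum>m<M. c m * A m k) + (\<Sum>m<M. (c m)\<^sup>2 * (1 / w m))"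
      by (rule sums_unique [symmetric]) (rule weighted_residual [OF orth])
    \<comment> \<open>Completing the square in each \<open>c m\<close>: this sum is the residual of
      \<open>c\<close> minus \<open>R M\<close>.\<close>
    have "0 \<le> (\<Sum>m<M. (c m - w m * r k * A m k)\<^sup>2 / w m)"
      using w by (intro sum_nonneg) (simp add: less_imp_le)
    also have "\<dots> = (\<Sum>m<M. (c m)\<^sup>2 * (1 / w m) - 2 * r k * (c m * A m k) + (r k)\<^sup>2 * (w m * (A m k)\<^sup>2))"
      using w by (intro sum.cong refl)
        (simp add: power2_eq_square field_simps less_imp_neq [symmetric])
    also have "\<dots> = (\<Sum>m<M. (c m)\<^sup>2 * (1 / w m)) - 2 * r k * (\<Sum>m<M. c m * A m k)
        + (r k)\<^sup>2 * (\<Sum>m<M. w m * (A m k)\<^sup>2)"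
      by (simp only: sum.distrib sum_subtractf sum_distrib_left)
    finally have "R M < \<epsilon>" using Mc eq unfolding R_def by linarith
    then have "norm (R N - 0) < \<epsilon>" if "N \<ge> M" for N
      using nonneg [of N] anti [OF that] by simp
    then show "\<exists>no. \<forall>N\<ge>no. norm (R N - 0) < \<epsilon>" by blast
  qed
  \<comment> \<open>The value at \<open>l\<close> of the residual of the delta at \<open>k\<close>.
    As one term of the series for \<open>R M\<close> it tends to 0, and this pointwise limit is the
    column relation.\<close>
  define x where "x M = (if l = k then 1 else 0) - (\<Sum>m<M. (w m * r k * A m k) * A m l)" for M
  have "r l * (x M)\<^sup>2 \<le> R M" for M
    using sum_le_suminf [OF sums_summable [OF res], of "{l}" M] r
      sums_unique [OF res, of M]
    by (simp add: x_def less_imp_le)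
  then have "(\<lambda>M. r l * (x M)\<^sup>2) \<longlonglongrightarrow> 0"
    using r by (intro tendsto_sandwich [OF _ _ tendsto_const lim]) (auto simp: less_imp_le)
  then have "(\<lambda>M. (1 / r l) * (r l * (x M)\<^sup>2)) \<longlonglongrightarrow> (1 / r l) * 0"
    by (intro tendsto_intros)
  then have "(\<lambda>M. (x M)\<^sup>2) \<longlonglongrightarrow> 0"
    using r [of l] by simp
  then have "x \<longlonglongrightarrow> 0"
    by simp
  then have "(\<lambda>M. ((if l = k then 1 else 0) - x M) / r k) \<longlonglongrightarrow> ((if l = k then 1 else 0) - 0) / r k"
    using r [of k] by (intro tendsto_intros) auto
  also have "(\<lambda>M. ((if l = k then 1 else 0) - x M) / r k) = (\<lambda>M. \<Sum>m<M. w m * (A m k * A m l))"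
  proof
    fix M
    have "(\<Sum>m<M. (w m * r k * A m k) * A m l) = r k * (\<Sum>m<M. w m * (A m k * A m l))"
      by (simp add: sum_distrib_left algebra_simps)
    then show "((if l = k then 1 else 0) - x M) / r k = (\<Sum>m<M. w m * (A m k * A m l))"
      using r [of k] by (simp add: x_def)
  qed
  finally show ?thesis
    unfolding sums_def by (auto split: if_splits)
qed

text \<open>Elimination from the top: a multiple of \<open>P N\<close> removes the coefficient at
  \<open>N\<close>. The assumption \<open>nz\<close> makes the leading coefficient of
  \<open>P 0\<close> nonzero, which its degree alone does not.\<close>

lemma poly_span_of_degrees:
  fixes P :: "nat \<Rightarrow> 'a :: field poly"
  assumes deg: "\<And>n. degree (P n) = n" and nz: "\<And>n. P n \<noteq> 0"
  shows "\<exists>N c. p = (\<Sum>n<N. smult (c n) (P n))"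
proof -
  have "\<exists>c. p = (\<Sum>n<N. smult (c n) (P n))" if "\<forall>i\<ge>N. coeff p i = 0" for N p
    using that
  proof (induction N arbitrary: p)
    case 0
    then show ?case by (simp add: poly_eq_iff)
  next
    case (Suc N)
    define b where "b = coeff p N / lead_coeff (P N)"
    have lc: "coeff (P N) N \<noteq> 0"
      using nz [of N] deg [of N] by (metis leading_coeff_0_iff)
    have "coeff (p - smult b (P N)) i = 0" if "i \<ge> N" for i
    proof (cases "i = N")
      case True
      then show ?thesis using lc by (simp add: b_def deg)
    next
      case False
      then show ?thesis using Suc.prems that deg [of N] by (simp add: coeff_eq_0)
    qed
    then obtain c where c: "p - smult b (P N) = (\<Sum>n<N. smult (c n) (P n))"
      using Suc.IH by blast
    have "p = (\<Sum>n<Suc N. smult ((c(N := b)) n) (P n))"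
      using c by (simp add: algebra_simps)
    then show ?case by blast
  qed
  moreover have "\<forall>i\<ge>Suc (degree p). coeff p i = 0"
    by (simp add: coeff_eq_0)
  ultimately show ?thesis by blast
qed

section \<open>Euler's series and the \<open>q\<close>-Chu--Vandermonde sum\<close>

locale dual_alternative_charlier =
  fixes a q :: real
  assumes q_pos: "0 < q" and q_less_1: "q < 1" and a_pos: "0 < a"
begin

lemma q_nonzero [simp]: "q \<noteq> 0" and a_nonzero [simp]: "a \<noteq> 0"
  using q_pos a_pos by auto

text \<open>Equal to \<open>q^(n(n-1)/2) / (q;q)_n\<close>.\<close>

definition euler_coeff :: "nat \<Rightarrow> real" where
  "euler_coeff n = (\<Prod>i<n. q ^ i / (1 - q ^ Suc i))"

text \<open>This is \<open>(-z;q)_\<infinity>\<close>, taken as a power series because the moments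
  of the masses \<open>rho\<close> are values of it.\<close>

definition euler :: "real \<Rightarrow> real" where
  "euler z = (\<Sum>n. euler_coeff n * z ^ n)"

lemma power_Suc_less_1: "q ^ Suc i < 1"
  using q_pos q_less_1 by (intro power_Suc_less_one) auto

lemma euler_coeff_pos: "euler_coeff n > 0"
  unfolding euler_coeff_def using power_Suc_less_1 q_pos
  by (intro prod_pos divide_pos_pos) auto

lemma euler_coeff_Suc: "euler_coeff (Suc n) * (1 - q ^ Suc n) = euler_coeff n * q ^ n"
  using power_Suc_less_1 [of n] by (simp add: euler_coeff_def)

lemma power_q_tendsto_0: "(\<lambda>n. q ^ n) \<longlonglongrightarrow> 0"
  using q_pos q_less_1 by (intro LIMSEQ_realpow_zero) auto

lemma summable_euler: "summable (\<lambda>n. euler_coeff n * z ^ n)"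
proof -
  have "(\<lambda>n. q ^ n / (1 - q ^ Suc n) * \<bar>z\<bar>) \<longlonglongrightarrow> 0 / (1 - 0) * \<bar>z\<bar>"
    by (intro tendsto_intros power_q_tendsto_0 LIMSEQ_Suc [OF power_q_tendsto_0]) auto
  then have "\<forall>\<^sub>F n in sequentially. q ^ n / (1 - q ^ Suc n) * \<bar>z\<bar> < 1 / 2"
    by (intro order_tendstoD) auto
  then obtain N where N: "\<And>n. n \<ge> N \<Longrightarrow> q ^ n / (1 - q ^ Suc n) * \<bar>z\<bar> < 1 / 2"
    by (auto simp: eventually_sequentially)
  show ?thesis
  proof (rule summable_ratio_test [of "1 / 2" N])
    fix n assume "n \<ge> N"
    have "norm (euler_coeff (Suc n) * z ^ Suc n)
        = (q ^ n / (1 - q ^ Suc n) * \<bar>z\<bar>) * norm (euler_coeff n * z ^ n)"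
      using power_Suc_less_1 [of n] q_pos by (simp add: euler_coeff_def abs_mult power_abs)
    also have "\<dots> \<le> 1 / 2 * norm (euler_coeff n * z ^ n)"
      using N [OF \<open>n \<ge> N\<close>] by (intro mult_right_mono) auto
    finally show "norm (euler_coeff (Suc n) * z ^ Suc n) \<le> 1 / 2 * norm (euler_coeff n * z ^ n)" .
  qed simp
qed

lemma sums_euler: "(\<lambda>n. euler_coeff n * z ^ n) sums euler z"
  unfolding euler_def by (rule summable_sums [OF summable_euler])

text \<open>Subtract the two series: the constant terms cancel, and \<open>euler_coeff_Suc\<close>
  turns the shifted difference into \<open>z\<close> times the series at
  \<open>z * q\<close>.\<close>

lemma euler_rec: "euler z = (1 + z) * euler (z * q)"
proof -
  have "(\<lambda>n. euler_coeff n * z ^ n - euler_coeff n * (z * q) ^ n) sums (euler z - euler (z * q))"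
    by (intro sums_diff sums_euler)
  then have "(\<lambda>n. euler_coeff (Suc n) * z ^ Suc n - euler_coeff (Suc n) * (z * q) ^ Suc n)
      sums (euler z - euler (z * q))"
    by (subst sums_Suc_iff) simp
  also have "(\<lambda>n. euler_coeff (Suc n) * z ^ Suc n - euler_coeff (Suc n) * (z * q) ^ Suc n)
      = (\<lambda>n. z * (euler_coeff n * (z * q) ^ n))"
  proof
    fix n
    have "euler_coeff (Suc n) * z ^ Suc n - euler_coeff (Suc n) * (z * q) ^ Suc n
        = (euler_coeff (Suc n) * (1 - q ^ Suc n)) * z ^ Suc n"
      by (simp add: power_mult_distrib algebra_simps)
    also have "\<dots> = z * (euler_coeff n * (z * q) ^ n)"
      unfolding euler_coeff_Suc by (simp add: power_mult_distrib)
    finally show "euler_coeff (Suc n) * z ^ Suc n - euler_coeff (Suc n) * (z * q) ^ Suc n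
        = z * (euler_coeff n * (z * q) ^ n)" .
  qed
  finally have "(\<lambda>n. z * (euler_coeff n * (z * q) ^ n)) sums (euler z - euler (z * q))" .
  moreover have "(\<lambda>n. z * (euler_coeff n * (z * q) ^ n)) sums (z * euler (z * q))"
    by (intro sums_mult sums_euler)
  ultimately have "euler z - euler (z * q) = z * euler (z * q)"
    by (rule sums_unique2)
  then show ?thesis by (simp add: algebra_simps)
qed

lemma euler_qpoch: "euler z = qpoch (- z) q n * euler (z * q ^ n)"
proof (induction n)
  case 0
  then show ?case by (simp add: qpoch_def)
next
  case (Suc n)
  have "euler (z * q ^ n) = (1 + z * q ^ n) * euler (z * q ^ Suc n)"
    using euler_rec [of "z * q ^ n"] by (simp add: mult_ac)
  with Suc show ?case by (simp add: qpoch_def)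
qed

lemma euler_0: "euler 0 = 1"
  unfolding euler_def powser_zero by (simp add: euler_coeff_def)

lemma isCont_euler: "isCont euler z"
proof -
  have "isCont (\<lambda>z. \<Sum>n. euler_coeff n * z ^ n) z"
    by (rule isCont_powser [of euler_coeff "\<bar>z\<bar> + 1"]) (rule summable_euler, simp)
  then show ?thesis unfolding euler_def [abs_def] .
qed

lemma euler_pos: "z \<ge> 0 \<Longrightarrow> euler z > 0"
  unfolding euler_def
  using suminf_pos2 [OF summable_euler, of z 0] euler_coeff_pos
  by (simp add: less_imp_le)

text \<open>Iterating \<open>euler_rec\<close> splits off the partial products, and the remaining
  factor \<open>euler (z * q ^ n)\<close> tends to \<open>euler 0 = 1\<close> by continuity.
  Positivity of \<open>z\<close> keeps that factor nonzero and reduces convergence of the product to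
  a geometric series.\<close>

lemma qpoch_inf_eq_euler:
  assumes "z > 0"
  shows "qpoch_inf (- z) q = euler z"
proof -
  have "(\<lambda>n. z * q ^ n) \<longlonglongrightarrow> z * 0"
    by (intro tendsto_intros power_q_tendsto_0)
  then have "(\<lambda>n. euler (z * q ^ n)) \<longlonglongrightarrow> 1"
    using isCont_tendsto_compose [OF isCont_euler [of 0]] by (simp add: euler_0)
  then have "(\<lambda>n. euler z / euler (z * q ^ n)) \<longlonglongrightarrow> euler z / 1"
    by (intro tendsto_intros) auto
  moreover have "euler z / euler (z * q ^ n) = (\<Prod>i<n. 1 + z * q ^ i)" for n
  proof -
    have "euler (z * q ^ n) > 0" using assms q_pos by (intro euler_pos) auto
    then show ?thesis using euler_qpoch [of z n] by (simp add: qpoch_def)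
  qed
  ultimately have lim: "(\<lambda>n. \<Prod>i<n. 1 + z * q ^ i) \<longlonglongrightarrow> euler z" by simp
  have "summable (\<lambda>i. z * q ^ i)"
    using q_pos q_less_1 by (intro summable_mult summable_geometric) auto
  then have "convergent_prod (\<lambda>i. 1 + z * q ^ i)"
    using assms q_pos by (subst convergent_prod_iff_summable_real) auto
  then have "(\<lambda>n. \<Prod>i\<le>n. 1 + z * q ^ i) \<longlonglongrightarrow> prodinf (\<lambda>i. 1 + z * q ^ i)"
    by (rule convergent_prod_LIMSEQ)
  moreover have "(\<lambda>n. \<Prod>i\<le>n. 1 + z * q ^ i) \<longlonglongrightarrow> euler z"
    using LIMSEQ_Suc [OF lim] by (simp only: lessThan_Suc_atMost)
  ultimately show ?thesis
    unfolding qpoch_inf_def by (simp add: LIMSEQ_unique)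
qed

section \<open>Newton basis at the nodes \<open>1, q, q^2, ...\<close> and its moments\<close>

definition falling :: "nat \<Rightarrow> real poly" where
  "falling k = (\<Prod>i<k. [:- (q ^ i), 1:])"

text \<open>Normalised so that the \<open>j\<close>-th moment of these masses at
  \<open>q ^ n\<close> is \<open>euler (a * q ^ (j + 1))\<close>.\<close>

definition rho :: "nat \<Rightarrow> real" where
  "rho n = euler_coeff n * (a * q) ^ n"

lemma rho_pos: "rho n > 0"
  using euler_coeff_pos q_pos a_pos by (simp add: rho_def)

lemma falling_Suc: "poly (falling (Suc k)) x = poly (falling k) x * (x - q ^ k)"
  by (simp add: falling_def algebra_simps)

lemma degree_falling: "degree (falling k) = k"
  unfolding falling_def by (subst degree_prod_eq_sum_degree) auto

lemma lead_coeff_falling: "coeff (falling k) k = 1"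
  using lead_coeff_prod [of "\<lambda>i. [:- (q ^ i), 1:]" "{..<k}"]
  by (simp add: degree_falling flip: falling_def)

text \<open>Induction on \<open>k\<close> with \<open>j\<close> free: the new factor
  \<open>x - q ^ k\<close> gives the moment for \<open>Suc j\<close> minus \<open>q ^ k\<close>
  times the one for \<open>j\<close>. This is a multiple of a difference of neighbouring Euler
  values, which \<open>euler_rec\<close> turns into a single value.\<close>

lemma moment_falling:
  "(\<lambda>n. rho n * (poly (falling k) (q ^ n) * (q ^ n) ^ j))
     sums ((- a) ^ k * q ^ (k * k + k * j) * euler (a * q ^ (k + j + 1)))"
proof (induction k arbitrary: j)
  case 0
  show ?case
    using sums_euler [of "a * q ^ (j + 1)"]
    by (simp add: rho_def falling_def power_mult_distrib mult_ac flip: power_mult)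
next
  case (Suc k)
  let ?z = "a * q ^ (k + j + 1)"
  have "(\<lambda>n. rho n * (poly (falling k) (q ^ n) * (q ^ n) ^ Suc j)
           - q ^ k * (rho n * (poly (falling k) (q ^ n) * (q ^ n) ^ j)))
     sums ((- a) ^ k * q ^ (k * k + k * Suc j) * euler (a * q ^ (k + Suc j + 1))
           - q ^ k * ((- a) ^ k * q ^ (k * k + k * j) * euler ?z))"
    by (intro sums_diff sums_mult Suc.IH)
  also have "(\<lambda>n. rho n * (poly (falling k) (q ^ n) * (q ^ n) ^ Suc j)
           - q ^ k * (rho n * (poly (falling k) (q ^ n) * (q ^ n) ^ j)))
      = (\<lambda>n. rho n * (poly (falling (Suc k)) (q ^ n) * (q ^ n) ^ j))"
    by (simp add: falling_Suc algebra_simps)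
  also have "(- a) ^ k * q ^ (k * k + k * Suc j) * euler (a * q ^ (k + Suc j + 1))
           - q ^ k * ((- a) ^ k * q ^ (k * k + k * j) * euler ?z)
      = (- a) ^ k * q ^ (k * k + k * Suc j) * (euler (?z * q) - euler ?z)"
    by (simp add: power_add algebra_simps)
  also have "euler (?z * q) - euler ?z = - ?z * euler (?z * q)"
    by (subst euler_rec [of ?z]) (simp only: algebra_simps, simp)
  also have "(- a) ^ k * q ^ (k * k + k * Suc j) * (- ?z * euler (?z * q))
      = (- a) ^ Suc k * q ^ (Suc k * Suc k + Suc k * j) * euler (a * q ^ (Suc k + j + 1))"
    by (simp add: power_add algebra_simps)
  finally show ?case .
qed

section \<open>Signed q-binomial coefficients and the q-Chu-Vandermonde sum\<close>

lemma qpoch_Suc_left: "qpoch x q (Suc k) = (1 - x) * qpoch (x * q) q k"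
  by (simp add: qpoch_def prod.lessThan_Suc_shift mult_ac del: prod.lessThan_Suc)

text \<open>This is \<open>(-1)^k q^(k(k-1)/2)\<close> times the Gaussian binomial of
  \<open>m\<close> over \<open>k\<close>, or \<open>(q^-m;q)_k q^(m k) / (q;q)_k\<close>.\<close>

definition signed_qbinom :: "nat \<Rightarrow> nat \<Rightarrow> real" where
  "signed_qbinom m k = poly (falling k) (q ^ m) / qpoch q q k"

lemma falling_eq_0: "m < k \<Longrightarrow> poly (falling k) (q ^ m) = 0"
  by (auto simp: falling_def poly_prod)

lemma signed_qbinom_0: "signed_qbinom m 0 = 1"
  by (simp add: signed_qbinom_def falling_def qpoch_def)

text \<open>A q-Pascal rule. At \<open>q ^ Suc m\<close> the first factor of
  \<open>falling (Suc k)\<close> is \<open>q ^ Suc m - 1\<close>, and each later one is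
  \<open>q\<close> times a factor of \<open>falling k\<close> at \<open>q ^ m\<close>.\<close>

lemma signed_qbinom_Suc:
  "signed_qbinom (Suc m) (Suc k) = signed_qbinom m (Suc k) - q ^ m * signed_qbinom m k"
proof -
  let ?f = "poly (falling k) (q ^ m)"
  have "poly (falling (Suc k)) (q ^ Suc m) = (q ^ Suc m - 1) * (\<Prod>i<k. q * (q ^ m - q ^ i))"
    by (simp add: falling_def poly_prod prod.lessThan_Suc_shift algebra_simps del: prod.lessThan_Suc)
  then have 1: "poly (falling (Suc k)) (q ^ Suc m) = (q ^ Suc m - 1) * q ^ k * ?f"
    by (simp add: prod.distrib falling_def poly_prod)
  have 2: "qpoch q q (Suc k) = qpoch q q k * (1 - q ^ Suc k)"
    by (simp add: qpoch_def)
  have "signed_qbinom (Suc m) (Suc k) - signed_qbinom m (Suc k)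
      = ((q ^ Suc m - 1) * q ^ k * ?f - ?f * (q ^ m - q ^ k)) / qpoch q q (Suc k)"
    by (simp only: signed_qbinom_def 1 falling_Suc [of k "q ^ m"] diff_divide_distrib)
  also have "(q ^ Suc m - 1) * q ^ k * ?f - ?f * (q ^ m - q ^ k) = - (q ^ m) * ?f * (1 - q ^ Suc k)"
    by (simp add: algebra_simps)
  also have "\<dots> / qpoch q q (Suc k) = - (q ^ m) * signed_qbinom m k"
    using power_Suc_less_1 [of k] by (simp add: 2 signed_qbinom_def)
  finally show ?thesis by simp
qed

text \<open>The \<open>q\<close>-Chu--Vandermonde sum
  \<open>\<^sub>2\<phi>\<^sub>1(q\<^sup>-\<^sup>m, b; bt; q, tq\<^sup>m) = (t;q)\<^sub>m / (bt;q)\<^sub>m\<close>, multiplied by \<open>(bt;q)\<^sub>\<infinity>\<close>.\<close>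

lemma q_chu_vandermonde:
  "(\<Sum>k\<le>m. signed_qbinom m k * t ^ k * qpoch b q k * euler (- b * t * q ^ k))
     = qpoch t q m * euler (- b * t * q ^ m)"
proof (induction m arbitrary: b)
  case 0
  show ?case by (simp add: signed_qbinom_0 qpoch_def)
next
  case (Suc m)
  \<comment> \<open>Raising the index of \<open>F\<close> replaces \<open>b\<close> by
    \<open>b * q\<close>, up to the factor \<open>t * (1 - b)\<close>. The Pascal rule thus leads to
    the induction hypothesis at \<open>b\<close> and at \<open>b * q\<close>, so \<open>b\<close>
    has to be arbitrary.\<close>
  define F where "F b k = t ^ k * qpoch b q k * euler (- b * t * q ^ k)" for b k
  have F_Suc: "F b (Suc k) = t * (1 - b) * F (b * q) k" for b k
    by (simp add: F_def qpoch_Suc_left mult_ac)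
  have IH: "(\<Sum>k\<le>m. signed_qbinom m k * F b k) = qpoch t q m * euler (- b * t * q ^ m)" for b
    using Suc.IH [of b] by (simp add: F_def mult_ac)
  have "(\<Sum>k\<le>Suc m. signed_qbinom (Suc m) k * F b k)
      = F b 0 + (\<Sum>k\<le>m. signed_qbinom (Suc m) (Suc k) * F b (Suc k))"
    by (simp add: sum.atMost_Suc_shift signed_qbinom_0 del: sum.atMost_Suc)
  also have "(\<Sum>k\<le>m. signed_qbinom (Suc m) (Suc k) * F b (Suc k))
      = (\<Sum>k\<le>m. signed_qbinom m (Suc k) * F b (Suc k)) - q ^ m * t * (1 - b) * (\<Sum>k\<le>m. signed_qbinom m k * F (b * q) k)"
  proof -
    have "signed_qbinom (Suc m) (Suc k) * F b (Suc k)
        = signed_qbinom m (Suc k) * F b (Suc k) - q ^ m * t * (1 - b) * (signed_qbinom m k * F (b * q) k)" for k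
      by (simp only: signed_qbinom_Suc left_diff_distrib F_Suc [of b k]) (simp only: mult_ac)
    then show ?thesis by (simp only: sum_subtractf sum_distrib_left)
  qed
  also have "F b 0 + ((\<Sum>k\<le>m. signed_qbinom m (Suc k) * F b (Suc k)) - q ^ m * t * (1 - b) * (\<Sum>k\<le>m. signed_qbinom m k * F (b * q) k))
     = (\<Sum>k\<le>Suc m. signed_qbinom m k * F b k) - q ^ m * t * (1 - b) * (\<Sum>k\<le>m. signed_qbinom m k * F (b * q) k)"
    by (simp add: sum.atMost_Suc_shift signed_qbinom_0 del: sum.atMost_Suc)
  also have "(\<Sum>k\<le>Suc m. signed_qbinom m k * F b k) = (\<Sum>k\<le>m. signed_qbinom m k * F b k)"
    by (simp add: signed_qbinom_def falling_eq_0)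
  also have "\<dots> - q ^ m * t * (1 - b) * (\<Sum>k\<le>m. signed_qbinom m k * F (b * q) k)
     = qpoch t q m * (euler (- b * t * q ^ m) - q ^ m * t * (1 - b) * euler (- b * t * q ^ Suc m))"
    unfolding IH by (simp add: algebra_simps)
  \<comment> \<open>Now both Euler values agree, and
    \<open>(1 - b * t * q ^ m) - q ^ m * t * (1 - b) = 1 - t * q ^ m\<close> is the missing
    factor.\<close>
  also have "euler (- b * t * q ^ m) = (1 - b * t * q ^ m) * euler (- b * t * q ^ Suc m)"
    by (subst euler_rec) (simp add: mult_ac)
  also have "qpoch t q m * ((1 - b * t * q ^ m) * euler (- b * t * q ^ Suc m)
        - q ^ m * t * (1 - b) * euler (- b * t * q ^ Suc m))
     = qpoch t q (Suc m) * euler (- b * t * q ^ Suc m)"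
    by (simp add: qpoch_def algebra_simps)
  finally show ?case by (simp add: F_def mult_ac)
qed

end

section \<open>Orthogonality in the dual variable\<close>

context dual_alternative_charlier
begin

definition charlier_coeff :: "nat \<Rightarrow> nat \<Rightarrow> real" where
  "charlier_coeff m k =
     signed_qbinom m k * qpoch (- a * q ^ m) q k / ((q ^ m) ^ k * q ^ (k * (k - 1)) * (- a) ^ k)"

text \<open>Up to a factor depending only on \<open>m\<close>, this is the alternative \<open>q\<close>-Charlier polynomial of degree
  \<open>m\<close>, written in the form in which the variables \<open>n\<close> and \<open>m\<close> of \<open>d\<^sub>n(\<mu>(m))\<close> exchange their roles.\<close>

definition charlier :: "nat \<Rightarrow> real poly" where
  "charlier m = (\<Sum>k\<le>m. smult (charlier_coeff m k) (falling k))"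

lemma qpoch_neg_power: "qpoch (q powi (- int m)) q k * (q ^ m) ^ k = poly (falling k) (q ^ m)"
proof -
  have "qpoch (q powi (- int m)) q k * (q ^ m) ^ k = (\<Prod>j<k. (1 - q powi (- int m) * q ^ j) * q ^ m)"
    by (simp add: qpoch_def prod.distrib)
  also have "\<dots> = poly (falling k) (q ^ m)"
    unfolding falling_def poly_prod
    by (intro prod.cong refl) (simp add: power_int_minus field_simps)
  finally show ?thesis .
qed

text \<open>Rewriting \<open>(q^-m;q)_k\<close> and \<open>(q^-n;q)_k\<close> through
  \<open>falling\<close> cancels the power \<open>(q ^ n) ^ k\<close> of the argument, so
  \<open>n\<close> enters only through \<open>falling k\<close> at \<open>q ^ n\<close>.\<close>

lemma dual_charlier_sum_eq: "dual_charlier_sum n a q m = poly (charlier m) (q ^ n)"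
proof -
  define T where "T k = charlier_coeff m k * poly (falling k) (q ^ n)" for k
  have T: "qpoch (q powi (- int m)) q k * qpoch (- a * q ^ m) q k * qpoch (q powi (- int n)) q k
              / qpoch q q k * q powi (- (int k * (int k - 1))) * (- (q ^ n) / a) ^ k = T k" for k
  proof -
    have "int k * (int k - 1) = int (k * (k - 1))"
      by (cases k) (auto simp: algebra_simps)
    then have 1: "q powi (- (int k * (int k - 1))) = 1 / q ^ (k * (k - 1))"
      by (simp only: power_int_minus power_int_of_nat inverse_eq_divide)
    have 2: "(- (q ^ n) / a) ^ k = (q ^ n) ^ k / (- a) ^ k"
      by (metis minus_divide_left minus_divide_right power_divide)
    have 3: "qpoch (q powi (- int i)) q k = poly (falling k) (q ^ i) / (q ^ i) ^ k" for i
      using qpoch_neg_power [of i k] q_pos by (simp add: field_simps)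
    have "(q ^ n) ^ k \<noteq> 0" using q_pos by simp
    then show ?thesis
      unfolding 1 2 3 T_def charlier_coeff_def signed_qbinom_def
      by (simp add: mult_ac)
  qed
  \<comment> \<open>Terms with \<open>k > n\<close> vanish through \<open>falling k\<close> at
    \<open>q ^ n\<close>, those with \<open>k > m\<close> through \<open>signed_qbinom\<close>, so
    the sum may end at either bound.\<close>
  have "(\<Sum>k\<le>n. T k) = (\<Sum>k\<le>max m n. T k)"
    by (intro sum.mono_neutral_left) (auto simp: T_def falling_eq_0)
  also have "\<dots> = (\<Sum>k\<le>m. T k)"
    by (intro sum.mono_neutral_right) (auto simp: T_def charlier_coeff_def signed_qbinom_def falling_eq_0)
  finally show ?thesis
    unfolding dual_charlier_sum_def T by (simp add: charlier_def poly_sum T_def)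
qed

lemma moment_charlier:
  "(\<lambda>n. rho n * (poly (charlier m) (q ^ n) * (q ^ n) ^ j))
     sums (qpoch (q ^ (j + 1) / q ^ m) q m * euler (a * q ^ (j + 1 + m)))"
proof -
  \<comment> \<open>These parameters make \<open>- ?b * ?t * q ^ k\<close> the Euler argument of
    \<open>moment_falling\<close>, and \<open>?t ^ k\<close> collects the powers of
    \<open>q\<close>, so that \<open>q_chu_vandermonde\<close> applies.\<close>
  let ?t = "q ^ (j + 1) / q ^ m" and ?b = "- a * q ^ m"
  have "(\<lambda>n. \<Sum>k\<le>m. charlier_coeff m k * (rho n * (poly (falling k) (q ^ n) * (q ^ n) ^ j)))
     sums (\<Sum>k\<le>m. charlier_coeff m k * ((- a) ^ k * q ^ (k * k + k * j) * euler (a * q ^ (k + j + 1))))"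
    by (rule sums_sum, rule sums_mult, rule moment_falling)
  also have "(\<lambda>n. \<Sum>k\<le>m. charlier_coeff m k * (rho n * (poly (falling k) (q ^ n) * (q ^ n) ^ j)))
     = (\<lambda>n. rho n * (poly (charlier m) (q ^ n) * (q ^ n) ^ j))"
    by (simp only: charlier_def poly_sum poly_smult sum_distrib_left sum_distrib_right mult_ac)
  also have "(\<Sum>k\<le>m. charlier_coeff m k * ((- a) ^ k * q ^ (k * k + k * j) * euler (a * q ^ (k + j + 1))))
     = (\<Sum>k\<le>m. signed_qbinom m k * ?t ^ k * qpoch ?b q k * euler (- ?b * ?t * q ^ k))"
  proof (intro sum.cong refl)
    fix k
    have "k * k + k * j = k * (k - 1) + (j + 1) * k"
      by (cases k) (auto simp: algebra_simps)
    then have 1: "q ^ (k * k + k * j) = q ^ (k * (k - 1)) * (q ^ (j + 1)) ^ k"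
      by (simp only: power_add power_mult)
    have 2: "- ?b * ?t * q ^ k = a * q ^ (k + j + 1)"
      using q_pos by (simp add: power_add field_simps)
    have nz: "(q ^ m) ^ k \<noteq> 0" "q ^ (k * (k - 1)) \<noteq> 0" "(- a) ^ k \<noteq> 0"
      using q_pos a_pos by auto
    show "charlier_coeff m k * ((- a) ^ k * q ^ (k * k + k * j) * euler (a * q ^ (k + j + 1)))
       = signed_qbinom m k * ?t ^ k * qpoch ?b q k * euler (- ?b * ?t * q ^ k)"
      unfolding 1 2 charlier_coeff_def power_divide using nz by (simp add: divide_simps)
  qed
  also have "\<dots> = qpoch ?t q m * euler (- ?b * ?t * q ^ m)"
    by (rule q_chu_vandermonde)
  also have "- ?b * ?t * q ^ m = a * q ^ (j + 1 + m)"
    using q_pos by (simp add: power_add field_simps)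
  finally show ?thesis .
qed

text \<open>The factor of index \<open>m - 1 - j\<close> in \<open>(q^(j+1-m);q)_m\<close> is
  \<open>1 - 1\<close>.\<close>

lemma moment_charlier_less:
  assumes "j < m"
  shows "(\<lambda>n. rho n * (poly (charlier m) (q ^ n) * (q ^ n) ^ j)) sums 0"
proof -
  have "q ^ (j + 1) * q ^ (m - 1 - j) = q ^ m"
    using assms by (simp flip: power_add power_Suc)
  then have "1 - q ^ (j + 1) / q ^ m * q ^ (m - 1 - j) = 0"
    using q_pos by (simp add: field_simps)
  then have "qpoch (q ^ (j + 1) / q ^ m) q m = 0"
    unfolding qpoch_def using assms by (intro prod_zero) (auto intro!: bexI [of _ "m - 1 - j"])
  then show ?thesis
    using moment_charlier [of m j] by simp
qed

text \<open>Powers below \<open>m\<close> contribute 0, and for the power \<open>m\<close> the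
  parameter \<open>q ^ (m + 1) / q ^ m\<close> is \<open>q\<close>.\<close>

lemma charlier_times_poly:
  assumes "degree p \<le> m"
  shows "(\<lambda>n. rho n * (poly (charlier m) (q ^ n) * poly p (q ^ n)))
           sums (coeff p m * (qpoch q q m * euler (a * q ^ (2 * m + 1))))"
proof -
  have "(\<lambda>n. \<Sum>j<m. coeff p j * (rho n * (poly (charlier m) (q ^ n) * (q ^ n) ^ j))) sums (\<Sum>j<m. coeff p j * 0)"
    by (intro sums_sum sums_mult moment_charlier_less) auto
  moreover have "(\<lambda>n. coeff p m * (rho n * (poly (charlier m) (q ^ n) * (q ^ n) ^ m)))
      sums (coeff p m * (qpoch (q ^ (m + 1) / q ^ m) q m * euler (a * q ^ (m + 1 + m))))"
    by (intro sums_mult moment_charlier)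
  ultimately have "(\<lambda>n. \<Sum>j<Suc m. coeff p j * (rho n * (poly (charlier m) (q ^ n) * (q ^ n) ^ j)))
      sums ((\<Sum>j<m. coeff p j * 0) + coeff p m * (qpoch (q ^ (m + 1) / q ^ m) q m * euler (a * q ^ (m + 1 + m))))"
    unfolding sum.lessThan_Suc by (rule sums_add)
  also have "(\<lambda>n. \<Sum>j<Suc m. coeff p j * (rho n * (poly (charlier m) (q ^ n) * (q ^ n) ^ j)))
      = (\<lambda>n. rho n * (poly (charlier m) (q ^ n) * poly p (q ^ n)))"
  proof
    fix n
    have "poly p (q ^ n) = (\<Sum>j\<le>degree p. coeff p j * (q ^ n) ^ j)"
      by (rule poly_altdef)
    also have "\<dots> = (\<Sum>j<Suc m. coeff p j * (q ^ n) ^ j)"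
      using assms by (intro sum.mono_neutral_left) (auto simp: coeff_eq_0)
    finally show "(\<Sum>j<Suc m. coeff p j * (rho n * (poly (charlier m) (q ^ n) * (q ^ n) ^ j)))
      = rho n * (poly (charlier m) (q ^ n) * poly p (q ^ n))"
      by (simp only: sum_distrib_left mult_ac)
  qed
  also have "q ^ (m + 1) / q ^ m = q" using q_pos by simp
  also have "m + 1 + m = 2 * m + 1" by simp
  finally show ?thesis by simp
qed

lemma degree_charlier_le: "degree (charlier m) \<le> m"
  unfolding charlier_def
proof (rule degree_sum_le)
  show "degree (smult (charlier_coeff m k) (falling k)) \<le> m" if "k \<in> {..m}" for k
    using that degree_smult_le [of "charlier_coeff m k" "falling k"] by (simp add: degree_falling)
qed simp

lemma coeff_charlier: "coeff (charlier m) m = charlier_coeff m m"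
proof -
  have "coeff (charlier m) m = (\<Sum>k\<le>m. charlier_coeff m k * coeff (falling k) m)"
    by (simp add: charlier_def coeff_sum)
  also have "\<dots> = (\<Sum>k\<le>m. if k = m then charlier_coeff m k else 0)"
    by (intro sum.cong refl) (auto simp: lead_coeff_falling coeff_eq_0 degree_falling)
  finally show ?thesis by simp
qed

section \<open>Squared norms, orthogonality and completeness of the rows\<close>

lemma falling_diag: "poly (falling m) (q ^ m) = (- 1) ^ m * q ^ (\<Sum>i<m. i) * qpoch q q m"
proof -
  \<comment> \<open>Pulling \<open>- q ^ i\<close> out of each factor leaves \<open>(q;q)_m\<close>
    in reverse order.\<close>
  have "poly (falling m) (q ^ m) = (\<Prod>i<m. (- 1) * q ^ i * (1 - q * q ^ (m - Suc i)))"
    unfolding falling_def poly_prod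
  proof (intro prod.cong refl)
    fix i assume "i \<in> {..<m}"
    then have "q ^ i * (q * q ^ (m - Suc i)) = q ^ m"
      by (simp flip: power_add power_Suc)
    then show "poly [:- (q ^ i), 1:] (q ^ m) = (- 1) * q ^ i * (1 - q * q ^ (m - Suc i))"
      by (simp add: algebra_simps)
  qed
  also have "\<dots> = (- 1) ^ m * q ^ (\<Sum>i<m. i) * (\<Prod>i<m. 1 - q * q ^ (m - Suc i))"
    unfolding prod.distrib by (simp add: power_sum)
  also have "(\<Prod>i<m. 1 - q * q ^ (m - Suc i)) = qpoch q q m"
    unfolding qpoch_def by (rule prod.nat_diff_reindex)
  finally show ?thesis .
qed

lemma qpoch_q_pos: "qpoch q q k > 0"
  unfolding qpoch_def using power_Suc_less_1 by (intro prod_pos) auto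

lemma weight_eq_euler:
  "weight a q m = (1 + a * q ^ (2 * m)) * a ^ m / (euler (a * q ^ m) * qpoch q q m) * q ^ (m * (3 * m - 1) div 2)"
  using qpoch_inf_eq_euler [of "a * q ^ m"] a_pos q_pos by (simp add: weight_def)

lemma weight_pos: "weight a q m > 0"
  unfolding weight_eq_euler using a_pos q_pos qpoch_q_pos [of m] euler_pos [of "a * q ^ m"]
  by (simp add: add_pos_pos)

text \<open>The weight contains the Euler value at \<open>a * q ^ m\<close>, the left side the one
  at \<open>a * q ^ (2 * m + 1)\<close>. Their ratio is the shifted factorial in
  \<open>charlier_coeff m m\<close> times \<open>1 + a * q ^ (2 * m)\<close>, which cancels the
  first factor of the weight.\<close>

lemma charlier_norm:
  "charlier_coeff m m * (qpoch q q m * euler (a * q ^ (2 * m + 1))) = 1 / weight a q m"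
proof -
  let ?s = "\<Sum>i<m. i" and ?e = "m * (3 * m - 1) div 2" and ?X = "a * q ^ (2 * m)"
  have s: "2 * (\<Sum>i<m. i) = m * (m - 1)" for m :: nat
  proof (induction m)
    case (Suc m)
    then show ?case by (cases m) auto
  qed simp
  \<comment> \<open>The equation \<open>x + 2 * y = 2 * z\<close> forces \<open>x\<close> to be
    even, so the integer division in the exponent \<open>?e\<close> is exact.\<close>
  have half: "x div 2 + y = z" if "x + 2 * y = 2 * z" for x y z :: nat
    using that by linarith
  have "m * (3 * m - 1) + m * (m - 1) = 2 * (m * m + m * (m - 1))"
    by (cases m) (auto simp: algebra_simps)
  then have "?e + ?s = m * m + m * (m - 1)"
    unfolding s [of m, symmetric] by (rule half)
  then have pow: "(q ^ m) ^ m * q ^ (m * (m - 1)) = q ^ ?e * q ^ ?s"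
    by (metis power_add power_mult)
  have E: "euler (a * q ^ m) = qpoch (- a * q ^ m) q m * ((1 + ?X) * euler (a * q ^ (2 * m + 1)))"
  proof -
    have "euler (a * q ^ m) = qpoch (- a * q ^ m) q m * euler ?X"
      using euler_qpoch [of "a * q ^ m" m] by (simp add: mult.assoc mult_2 flip: power_add)
    also have "euler ?X = (1 + ?X) * euler (a * q ^ (2 * m + 1))"
      by (subst euler_rec) (simp add: mult_ac)
    finally show ?thesis .
  qed
  have pos: "1 + ?X > 0" "qpoch q q m > 0" "q ^ ?e > 0" "q ^ ?s > 0" "a ^ m > 0"
    using a_pos q_pos qpoch_q_pos by (auto intro: add_pos_pos)
  have "charlier_coeff m m = q ^ ?s * qpoch (- a * q ^ m) q m / (q ^ ?e * q ^ ?s * a ^ m)"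
    unfolding charlier_coeff_def signed_qbinom_def falling_diag pow
    using pos power_mult_distrib [of "- 1" a m] by simp
  also have "\<dots> = qpoch (- a * q ^ m) q m / (q ^ ?e * a ^ m)"
    using pos by simp
  finally have C: "charlier_coeff m m = qpoch (- a * q ^ m) q m / (q ^ ?e * a ^ m)" .
  have W: "1 / (X * A / (P * (X * G) * Q) * Y) = P / (Y * A) * (Q * G)"
    if "X > 0" for X A P G Q Y :: real
    using that by (simp add: mult_ac)
  show ?thesis
    unfolding weight_eq_euler E C by (rule W [symmetric]) (use pos in simp)
qed

lemma charlier_coeff_diag_nonzero: "charlier_coeff m m \<noteq> 0"
  using charlier_norm [of m] weight_pos [of m] by auto

lemma charlier_nonzero: "charlier m \<noteq> 0"
  using coeff_charlier [of m] charlier_coeff_diag_nonzero [of m] by auto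

lemma degree_charlier: "degree (charlier m) = m"
  using degree_charlier_le [of m] coeff_charlier [of m] charlier_coeff_diag_nonzero [of m]
  by (metis le_antisym le_degree)

text \<open>By symmetry \<open>i \<le> j\<close>; then \<open>charlier i\<close> has coefficient 0
  at \<open>j\<close> unless \<open>i = j\<close>, and \<open>charlier_times_poly\<close> sees only
  that coefficient.\<close>

lemma charlier_orthogonal:
  "(\<lambda>n. rho n * (poly (charlier i) (q ^ n) * poly (charlier j) (q ^ n)))
     sums (if i = j then 1 / weight a q i else 0)"
proof (induction i j rule: linorder_wlog)
  case (le i j)
  then have "coeff (charlier i) j * (qpoch q q j * euler (a * q ^ (2 * j + 1)))
      = (if i = j then 1 / weight a q i else 0)"
    using charlier_norm [of j] by (auto simp: coeff_charlier coeff_eq_0 degree_charlier)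
  with charlier_times_poly [of "charlier i" j] le show ?case
    by (simp add: degree_charlier mult_ac)
next
  case (sym i j)
  then show ?case by (cases "i = j") (auto simp: mult_ac)
qed

text \<open>On the nodes \<open>q ^ n\<close> the delta at \<open>k\<close> agrees with a continuous
  function on \<open>[0, 1]\<close>. Since the total mass is finite, a uniformly close polynomial is
  close in the weighted norm, and it is a combination of the \<open>charlier m\<close>.\<close>

lemma charlier_complete:
  assumes "\<epsilon> > 0"
  shows "\<exists>M c. (\<Sum>n. rho n * ((if n = k then 1 else 0) - (\<Sum>m<M. c m * poly (charlier m) (q ^ n)))\<^sup>2) < \<epsilon>"
proof -
  have sum_rho: "summable rho"
    using summable_euler by (simp add: rho_def [abs_def])
  define R where "R = suminf rho"
  have R: "R > 0"
    unfolding R_def using sum_rho rho_pos by (rule suminf_pos)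
  define \<delta> where "\<delta> = sqrt (\<epsilon> / (2 * R))"
  have \<delta>: "\<delta> > 0" "R * \<delta>\<^sup>2 = \<epsilon> / 2"
    using R assms by (auto simp: \<delta>_def)
  \<comment> \<open>The distance from \<open>q ^ k\<close> to the next smaller node. Larger nodes
    are at least as far away, so the tent \<open>f\<close> of half-width \<open>h\<close> vanishes
    at every other node.\<close>
  define h where "h = q ^ k - q ^ Suc k"
  have h: "h > 0"
    using q_pos q_less_1 by (simp add: h_def)
  define f where "f x = max 0 (1 - \<bar>x - q ^ k\<bar> / h)" for x
  have f_power: "f (q ^ n) = (if n = k then 1 else 0)" for n
  proof -
    have "h \<le> \<bar>q ^ n - q ^ k\<bar>" if "n \<noteq> k"
    proof (cases "n < k")
      case True
      have le: "q ^ k \<le> q ^ Suc n" "q ^ k \<le> q ^ n"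
        using True q_pos q_less_1 by (auto intro!: power_decreasing simp del: power_Suc)
      have "h = q ^ k * (1 - q)" by (simp add: h_def algebra_simps)
      also have "\<dots> \<le> q ^ n * (1 - q)"
        using le q_less_1 by (intro mult_right_mono) auto
      also have "\<dots> = q ^ n - q ^ Suc n" by (simp add: algebra_simps)
      finally show ?thesis using le by linarith
    next
      case False
      then have "q ^ n \<le> q ^ Suc k"
        using that q_pos q_less_1 by (intro power_decreasing) auto
      then show ?thesis unfolding h_def by linarith
    qed
    then have "n \<noteq> k \<Longrightarrow> 1 \<le> \<bar>q ^ n - q ^ k\<bar> / h"
      using h by simp
    then show ?thesis by (auto simp: f_def)
  qed
  have "continuous_on {0..1} f"
    unfolding f_def by (intro continuous_intros) (use h in auto)
  then obtain g where g: "real_polynomial_function g" "\<And>x. x \<in> {0..1} \<Longrightarrow> \<bar>f x - g x\<bar> < \<delta>"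
    using Stone_Weierstrass_real_polynomial_function [OF compact_Icc] \<delta> by metis
  then obtain b :: "nat \<Rightarrow> real" and l where b: "g = (\<lambda>x. \<Sum>i\<le>l. b i * x ^ i)"
    using real_polynomial_function_imp_sum by blast
  obtain M c where Mc: "(\<Sum>i\<le>l. monom (b i) i) = (\<Sum>m<M. smult (c m) (charlier m))"
    using poly_span_of_degrees [OF degree_charlier charlier_nonzero] by blast
  have g_eq: "g x = (\<Sum>m<M. c m * poly (charlier m) x)" for x
    using arg_cong [OF Mc, of "\<lambda>p. poly p x"] by (simp add: b poly_sum poly_monom)
  have bound: "rho n * ((if n = k then 1 else 0) - g (q ^ n))\<^sup>2 \<le> rho n * \<delta>\<^sup>2" for n
  proof -
    have "\<bar>f (q ^ n) - g (q ^ n)\<bar> < \<delta>"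
      using q_pos q_less_1 by (intro g) (auto intro: power_le_one)
    then have "(f (q ^ n) - g (q ^ n))\<^sup>2 \<le> \<delta>\<^sup>2"
      using abs_le_square_iff [of "f (q ^ n) - g (q ^ n)" \<delta>] \<delta>(1) by simp
    then show ?thesis
      using rho_pos [of n] by (simp add: f_power)
  qed
  have sum_bound: "summable (\<lambda>n. rho n * \<delta>\<^sup>2)"
    using sum_rho by (rule summable_mult2)
  have "(\<Sum>n. rho n * ((if n = k then 1 else 0) - g (q ^ n))\<^sup>2) \<le> (\<Sum>n. rho n * \<delta>\<^sup>2)"
  proof (rule suminf_le [OF bound _ sum_bound])
    show "summable (\<lambda>n. rho n * ((if n = k then 1 else 0) - g (q ^ n))\<^sup>2)"
      by (rule summable_comparison_test' [OF sum_bound, of 0])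
         (use bound rho_pos in \<open>simp add: less_imp_le\<close>)
  qed
  also have "\<dots> = \<epsilon> / 2"
    using suminf_mult2 [OF sum_rho, of "\<delta>\<^sup>2"] \<delta>(2) by (simp add: R_def)
  finally show ?thesis
    using assms unfolding g_eq by (intro exI [of _ M] exI [of _ c]) simp
qed

section \<open>Transfer from rows to columns\<close>

lemma dual_charlier_orthogonal:
  "(\<lambda>m. weight a q m * (dual_charlier_sum k a q m * dual_charlier_sum l a q m))
     sums (if k = l then 1 / rho k else 0)"
  unfolding dual_charlier_sum_eq
  by (rule dual_orthogonality [where A = "\<lambda>m n. poly (charlier m) (q ^ n)",
        OF rho_pos weight_pos charlier_orthogonal charlier_complete])

text \<open>The residual identity is now used for the columns, with \<open>rho\<close> and
  \<open>weight\<close> exchanged. The residual tends to 0 because row \<open>k\<close> has squared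
  norm \<open>1 / weight a q k\<close>.\<close>

lemma dual_charlier_complete:
  assumes "\<epsilon> > 0"
  shows "\<exists>N c. (\<Sum>m. weight a q m * ((if m = k then 1 else 0) - (\<Sum>n<N. c n * dual_charlier_sum n a q m))\<^sup>2) < \<epsilon>"
proof -
  define c where "c n = rho n * weight a q k * dual_charlier_sum n a q k" for n
  define R where "R N = weight a q k - (weight a q k)\<^sup>2 * (\<Sum>n<N. rho n * (dual_charlier_sum n a q k)\<^sup>2)" for N
  have res: "(\<lambda>m. weight a q m * ((if m = k then 1 else 0) - (\<Sum>n<N. c n * dual_charlier_sum n a q m))\<^sup>2) sums R N" for N
    unfolding R_def c_def by (rule weighted_residual_fourier [OF rho_pos dual_charlier_orthogonal])
  have "(\<lambda>n. rho n * (dual_charlier_sum n a q k)\<^sup>2) sums (1 / weight a q k)"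
    using charlier_orthogonal [of k k] by (simp add: dual_charlier_sum_eq power2_eq_square)
  then have "R \<longlonglongrightarrow> weight a q k - (weight a q k)\<^sup>2 * (1 / weight a q k)"
    unfolding R_def sums_def by (intro tendsto_intros)
  then have "R \<longlonglongrightarrow> 0"
    using weight_pos [of k] by (simp add: power2_eq_square)
  then have "\<forall>\<^sub>F N in sequentially. R N < \<epsilon>"
    using assms by (rule order_tendstoD)
  then obtain N where "R N < \<epsilon>"
    by (auto simp: eventually_sequentially)
  with sums_unique [OF res, of N] show ?thesis
    by (intro exI [of _ N] exI [of _ c]) simp
qed

end

section \<open>Density in weighted \<open>\<ell>\<^sup>2\<close> spaces\<close>

lemma lin_combsI: "(\<lambda>x. \<Sum>n<N. c n * e n x) \<in> lin_combs e"
  unfolding lin_combs_def by blast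

lemma lin_combs_add:
  assumes "f \<in> lin_combs e" "g \<in> lin_combs e"
  shows "(\<lambda>x. f x + g x) \<in> lin_combs e"
proof -
  from assms obtain N c M d where f: "f = (\<lambda>x. \<Sum>n<N. c n * e n x)" and g: "g = (\<lambda>x. \<Sum>n<M. d n * e n x)"
    unfolding lin_combs_def by blast
  \<comment> \<open>Padding with zero coefficients gives both sums a common length.\<close>
  have extend: "(\<Sum>n<N. c n * e n x) = (\<Sum>n<max N M. (if n < N then c n else 0) * e n x)"
    for N M c x
    by (rule sum.mono_neutral_cong_left) auto
  have "(\<lambda>x. f x + g x) = (\<lambda>x. \<Sum>n<max N M. ((if n < N then c n else 0) + (if n < M then d n else 0)) * e n x)"
    unfolding f g using extend [of c _ N M] extend [of d _ M N]
    by (simp add: sum.distrib distrib_right max.commute)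
  then show ?thesis by (simp only: lin_combsI)
qed

lemma lin_combs_scale:
  assumes "f \<in> lin_combs e"
  shows "(\<lambda>x. b * f x) \<in> lin_combs e"
proof -
  from assms obtain N c where f: "f = (\<lambda>x. \<Sum>n<N. c n * e n x)"
    unfolding lin_combs_def by blast
  have "(\<lambda>x. b * f x) = (\<lambda>x. \<Sum>n<N. (b * c n) * e n x)"
    by (simp add: f sum_distrib_left mult.assoc)
  then show ?thesis by (simp only: lin_combsI)
qed

lemma lin_combs_zero: "(\<lambda>_. 0) \<in> lin_combs e"
  unfolding lin_combs_def by (auto intro!: exI [of _ 0])

text \<open>This follows from \<open>(norm x - norm y)^2 \<ge> 0\<close>. Summed with weights it
  replaces the triangle inequality of the weighted norm, at the cost of a factor 2.\<close>

lemma norm_add_square_le: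
  fixes x y :: "'a :: real_normed_vector"
  shows "(norm (x + y))\<^sup>2 \<le> 2 * (norm x)\<^sup>2 + 2 * (norm y)\<^sup>2"
proof -
  have "(norm (x + y))\<^sup>2 \<le> (norm x + norm y)\<^sup>2"
    by (intro power_mono norm_triangle_ineq) auto
  also have "\<dots> \<le> 2 * (norm x)\<^sup>2 + 2 * (norm y)\<^sup>2"
    using zero_le_power2 [of "norm x - norm y"] by (simp add: power2_sum power2_diff)
  finally show ?thesis .
qed

definition wl2_sq :: "(nat \<Rightarrow> real) \<Rightarrow> (nat \<Rightarrow> complex) \<Rightarrow> real" where
  "wl2_sq w f = (\<Sum>m. w m * (cmod (f m))\<^sup>2)"

lemma wl2_norm_eq:
  assumes "f \<in> wl2 w"
  shows "wl2_norm w f = sqrt (wl2_sq w f)"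
proof -
  have "of_real (w m) * f m * cnj (f m) = of_real (w m * (cmod (f m))\<^sup>2)" for m
    by (simp only: of_real_mult complex_norm_square mult.assoc)
  then have "wl2_inner w f f = of_real (wl2_sq w f)"
    using assms by (simp only: wl2_inner_def wl2_sq_def wl2_def mem_Collect_eq suminf_of_real)
  then show ?thesis by (simp add: wl2_norm_def)
qed

context
  fixes w :: "nat \<Rightarrow> real"
  assumes w: "\<And>m. w m \<ge> 0"
begin

lemma wl2_add:
  assumes "f \<in> wl2 w" "g \<in> wl2 w"
  shows wl2_add_in: "(\<lambda>m. f m + g m) \<in> wl2 w"
    and wl2_sq_add_le: "wl2_sq w (\<lambda>m. f m + g m) \<le> 2 * wl2_sq w f + 2 * wl2_sq w g"
proof -
  have bound: "w m * (cmod (f m + g m))\<^sup>2 \<le> 2 * (w m * (cmod (f m))\<^sup>2) + 2 * (w m * (cmod (g m))\<^sup>2)" for m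
    using mult_left_mono [OF norm_add_square_le [of "f m" "g m"] w [of m]] by (simp add: algebra_simps)
  have sums: "(\<lambda>m. 2 * (w m * (cmod (f m))\<^sup>2) + 2 * (w m * (cmod (g m))\<^sup>2))
      sums (2 * wl2_sq w f + 2 * wl2_sq w g)"
    unfolding wl2_sq_def using assms
    by (intro sums_add sums_mult summable_sums) (auto simp: wl2_def)
  show *: "(\<lambda>m. f m + g m) \<in> wl2 w"
    unfolding wl2_def mem_Collect_eq
    by (rule summable_comparison_test' [OF sums_summable [OF sums], of 0]) (use bound w in simp)
  show "wl2_sq w (\<lambda>m. f m + g m) \<le> 2 * wl2_sq w f + 2 * wl2_sq w g"
    unfolding wl2_sq_def [of w "\<lambda>m. f m + g m"] sums_unique [OF sums]
    by (rule suminf_le [OF bound]) (use * sums in \<open>auto simp: wl2_def sums_iff\<close>)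
qed

lemma wl2_scale:
  assumes "f \<in> wl2 w"
  shows wl2_scale_in: "(\<lambda>m. b * f m) \<in> wl2 w"
    and wl2_sq_scale: "wl2_sq w (\<lambda>m. b * f m) = (cmod b)\<^sup>2 * wl2_sq w f"
proof -
  have "(\<lambda>m. w m * (cmod (b * f m))\<^sup>2) = (\<lambda>m. (cmod b)\<^sup>2 * (w m * (cmod (f m))\<^sup>2))"
    by (simp add: norm_mult power_mult_distrib mult_ac)
  then show "(\<lambda>m. b * f m) \<in> wl2 w" "wl2_sq w (\<lambda>m. b * f m) = (cmod b)\<^sup>2 * wl2_sq w f"
    using assms by (simp_all add: wl2_def wl2_sq_def summable_mult suminf_mult)
qed

lemma wl2_diff_in: "f \<in> wl2 w \<Longrightarrow> g \<in> wl2 w \<Longrightarrow> (\<lambda>m. f m - g m) \<in> wl2 w"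
  using wl2_add_in [of f "\<lambda>m. (- 1) * g m"] wl2_scale_in [of g "- 1"] by simp

lemma wl2_finite_support: "(\<lambda>m. if m < M then f m else 0) \<in> wl2 w"
  unfolding wl2_def mem_Collect_eq
  by (rule summable_finite [of "{..<M}"]) auto

lemma lin_combs_subset_wl2:
  assumes "\<And>n. e n \<in> wl2 w"
  shows "lin_combs e \<subseteq> wl2 w"
proof
  fix f assume "f \<in> lin_combs e"
  then obtain N c where f: "f = (\<lambda>x. \<Sum>n<N. c n * e n x)"
    unfolding lin_combs_def by blast
  have "(\<lambda>x. \<Sum>n<N. c n * e n x) \<in> wl2 w" for N
  proof (induction N)
    case 0
    then show ?case by (simp add: wl2_def)
  next
    case (Suc N)
    then show ?case using wl2_add_in wl2_scale_in assms by simp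
  qed
  then show "f \<in> wl2 w" by (simp add: f)
qed

text \<open>Truncate \<open>f\<close> to finite support and assemble the truncation from deltas one
  at a time. Each use of \<open>wl2_sq_add_le\<close> doubles two errors, so both are kept below
  \<open>\<epsilon> / 4\<close>.\<close>

lemma wl2_dense_of_deltas:
  assumes e: "\<And>n. e n \<in> wl2 w"
    and delta: "\<And>k \<epsilon>. \<epsilon> > 0 \<Longrightarrow> \<exists>g\<in>lin_combs e. wl2_sq w (\<lambda>m. (if m = k then 1 else 0) - g m) < \<epsilon>"
    and f: "f \<in> wl2 w" and "\<epsilon> > 0"
  shows "\<exists>g\<in>lin_combs e. wl2_sq w (\<lambda>m. f m - g m) < \<epsilon>"
proof -
  note in_wl2 = subsetD [OF lin_combs_subset_wl2 [OF e]]
  define T where "T M = (\<lambda>m. if m < M then f m else 0)" for M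
  have T: "T M \<in> wl2 w" for M
    unfolding T_def by (rule wl2_finite_support)
  have fin: "\<exists>g\<in>lin_combs e. wl2_sq w (\<lambda>m. T M m - g m) < \<epsilon>" if "\<epsilon> > 0" for M \<epsilon>
    using that
  proof (induction M arbitrary: \<epsilon>)
    case 0
    then show ?case
      by (intro bexI [OF _ lin_combs_zero]) (simp add: T_def wl2_sq_def)
  next
    case (Suc M)
    \<comment> \<open>The added 1 keeps the divisor positive when \<open>f M = 0\<close>.\<close>
    let ?b = "(cmod (f M))\<^sup>2 + 1"
    define D where "D = (\<lambda>m. if m = M then 1 else 0 :: complex)"
    have b: "?b > 0"
      using zero_le_power2 [of "cmod (f M)"] by linarith
    obtain g where g: "g \<in> lin_combs e" "wl2_sq w (\<lambda>m. T M m - g m) < \<epsilon> / 4"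
      using Suc.IH [of "\<epsilon> / 4"] Suc.prems by auto
    obtain h where h: "h \<in> lin_combs e" "wl2_sq w (\<lambda>m. D m - h m) < \<epsilon> / (4 * ?b)"
      using delta [of "\<epsilon> / (4 * ?b)" M] Suc.prems b unfolding D_def by auto
    have "D = (\<lambda>m. if m < Suc M then D m else 0)" by (auto simp: D_def)
    then have D: "D \<in> wl2 w" using wl2_finite_support by metis
    note 1 = wl2_diff_in [OF T in_wl2 [OF g(1)]] and 2 = wl2_diff_in [OF D in_wl2 [OF h(1)]]
    have "(\<lambda>m. T (Suc M) m - (g m + f M * h m)) = (\<lambda>m. (T M m - g m) + f M * (D m - h m))"
      by (auto simp: T_def D_def algebra_simps less_Suc_eq)
    then have "wl2_sq w (\<lambda>m. T (Suc M) m - (g m + f M * h m))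
        \<le> 2 * wl2_sq w (\<lambda>m. T M m - g m) + 2 * ((cmod (f M))\<^sup>2 * wl2_sq w (\<lambda>m. D m - h m))"
      using wl2_sq_add_le [OF 1 wl2_scale_in [OF 2]] wl2_sq_scale [OF 2] by simp
    also have "(cmod (f M))\<^sup>2 * wl2_sq w (\<lambda>m. D m - h m) \<le> ?b * (\<epsilon> / (4 * ?b))"
    proof (intro mult_mono)
      show "0 \<le> wl2_sq w (\<lambda>m. D m - h m)"
        using 2 w by (auto simp: wl2_sq_def wl2_def intro!: suminf_nonneg)
    qed (use h b in auto)
    also have "?b * (\<epsilon> / (4 * ?b)) = \<epsilon> / 4"
    proof -
      have "B * (\<epsilon> / (4 * B)) = \<epsilon> / 4" if "B > 0" for B
        using that by simp
      then show ?thesis using b .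
    qed
    finally have "wl2_sq w (\<lambda>m. T (Suc M) m - (g m + f M * h m)) < \<epsilon>"
      using g(2) by simp
    then show ?case
      by (rule bexI [OF _ lin_combs_add [OF g(1) lin_combs_scale [OF h(1)]]])
  qed
  \<comment> \<open>The squared truncation error is the tail of a convergent series.\<close>
  have "(\<lambda>M. wl2_sq w (\<lambda>m. f m - T M m)) \<longlonglongrightarrow> 0"
  proof -
    have s: "(\<lambda>m. w m * (cmod (f m))\<^sup>2) sums wl2_sq w f"
      using f by (simp add: wl2_sq_def wl2_def summable_sums)
    have "(\<lambda>m. w m * (cmod (f m - T M m))\<^sup>2) sums (wl2_sq w f - (\<Sum>m<M. w m * (cmod (f m))\<^sup>2))" for M
    proof -
      have "(\<lambda>m. w m * (cmod (f m))\<^sup>2 - (if m \<in> {..<M} then w m * (cmod (f m))\<^sup>2 else 0))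
          sums (wl2_sq w f - (\<Sum>m<M. w m * (cmod (f m))\<^sup>2))"
        by (intro sums_diff s sums_If_finite_set) auto
      also have "(\<lambda>m. w m * (cmod (f m))\<^sup>2 - (if m \<in> {..<M} then w m * (cmod (f m))\<^sup>2 else 0))
          = (\<lambda>m. w m * (cmod (f m - T M m))\<^sup>2)"
        by (auto simp: T_def)
      finally show ?thesis .
    qed
    then have "(\<lambda>M. wl2_sq w (\<lambda>m. f m - T M m)) = (\<lambda>M. wl2_sq w f - (\<Sum>m<M. w m * (cmod (f m))\<^sup>2))"
      by (auto simp: wl2_sq_def sums_iff)
    moreover have "(\<lambda>M. wl2_sq w f - (\<Sum>m<M. w m * (cmod (f m))\<^sup>2)) \<longlonglongrightarrow> wl2_sq w f - wl2_sq w f"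
      using s unfolding sums_def by (intro tendsto_intros)
    ultimately show ?thesis by simp
  qed
  then have "\<forall>\<^sub>F M in sequentially. wl2_sq w (\<lambda>m. f m - T M m) < \<epsilon> / 4"
    using \<open>\<epsilon> > 0\<close> by (intro order_tendstoD) auto
  then obtain M where M: "wl2_sq w (\<lambda>m. f m - T M m) < \<epsilon> / 4"
    by (auto simp: eventually_sequentially)
  obtain g where g: "g \<in> lin_combs e" "wl2_sq w (\<lambda>m. T M m - g m) < \<epsilon> / 4"
    using fin [of "\<epsilon> / 4" M] \<open>\<epsilon> > 0\<close> by auto
  have "wl2_sq w (\<lambda>m. f m - g m) \<le> 2 * wl2_sq w (\<lambda>m. f m - T M m) + 2 * wl2_sq w (\<lambda>m. T M m - g m)"
    using wl2_sq_add_le [OF wl2_diff_in [OF f T] wl2_diff_in [OF T in_wl2 [OF g(1)]], of M M] by simp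
  also have "\<dots> < \<epsilon>" using M g(2) by simp
  finally show ?thesis using g(1) by blast
qed

end

section \<open>The point measure\<close>

lemma poly_of_real_map_poly: "poly (map_poly of_real p) (of_real x :: complex) = of_real (poly p x)"
  by (induction p) (simp_all add: map_poly_pCons)

context dual_alternative_charlier
begin

section \<open>The orthogonal basis of the weighted sequence space\<close>

definition basis_fun :: "nat \<Rightarrow> nat \<Rightarrow> complex" where
  "basis_fun n m = of_real (dual_charlier_sum n a q m)"

lemma poly_dual_charlier_mu: "poly (dual_charlier n a q) (mu a q m) = dual_charlier_sum n a q m"
  using poly_dual_charlier q_pos q_less_1 a_pos by simp

lemma dual_charlier_nonzero: "dual_charlier n a q \<noteq> 0"
proof
  assume "dual_charlier n a q = 0"
  then have "dual_charlier_sum n a q m = 0" for m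
    using poly_dual_charlier_mu [of n m] by simp
  then have "(\<lambda>_. 0) sums (1 / rho n)"
    using dual_charlier_orthogonal [of n n] by simp
  then show False
    using sums_unique2 [OF sums_zero] rho_pos [of n] by force
qed

lemma basis_fun_wl2: "basis_fun n \<in> wl2 (weight a q)"
  using sums_summable [OF dual_charlier_orthogonal [of n n]]
  by (simp add: wl2_def basis_fun_def power2_eq_square)

lemma weight_nonneg: "weight a q m \<ge> 0"
  using weight_pos by (rule less_imp_le)

lemma lin_combs_basis_fun_subset: "lin_combs basis_fun \<subseteq> wl2 (weight a q)"
  by (rule lin_combs_subset_wl2) (rule weight_nonneg, rule basis_fun_wl2)

text \<open>It suffices to approximate deltas; these are real, so the real coefficients of
  \<open>dual_charlier_complete\<close> serve as complex ones.\<close>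

lemma basis_fun_dense:
  assumes "f \<in> wl2 (weight a q)" "\<epsilon> > 0"
  shows "\<exists>g\<in>lin_combs basis_fun. wl2_sq (weight a q) (\<lambda>m. f m - g m) < \<epsilon>"
proof (rule wl2_dense_of_deltas [OF weight_nonneg basis_fun_wl2 _ assms])
  fix k and \<epsilon> :: real assume "\<epsilon> > 0"
  then obtain N c where Nc:
    "(\<Sum>m. weight a q m * ((if m = k then 1 else 0) - (\<Sum>n<N. c n * dual_charlier_sum n a q m))\<^sup>2) < \<epsilon>"
    using dual_charlier_complete by blast
  have "(if m = k then 1 else 0) - (\<Sum>n<N. of_real (c n) * basis_fun n m)
      = of_real ((if m = k then 1 else 0) - (\<Sum>n<N. c n * dual_charlier_sum n a q m))" for m
    by (simp add: basis_fun_def)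
  then have "wl2_sq (weight a q) (\<lambda>m. (if m = k then 1 else 0) - (\<Sum>n<N. of_real (c n) * basis_fun n m)) < \<epsilon>"
    unfolding wl2_sq_def using Nc by (simp only: norm_of_real power2_abs)
  then show "\<exists>g\<in>lin_combs basis_fun. wl2_sq (weight a q) (\<lambda>m. (if m = k then 1 else 0) - g m) < \<epsilon>"
    using lin_combsI by (rule bexI)
qed

lemma orthogonal_basis_basis_fun: "orthogonal_basis (weight a q) basis_fun"
  unfolding orthogonal_basis_def
proof (intro conjI allI impI ballI)
  show "basis_fun n \<in> wl2 (weight a q)" for n
    by (rule basis_fun_wl2)
  show "basis_fun n \<noteq> (\<lambda>_. 0)" for n
  proof
    assume "basis_fun n = (\<lambda>_. 0)"
    then have "dual_charlier_sum n a q m = 0" for m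
      by (metis basis_fun_def of_real_eq_0_iff)
    then show False
      using sums_unique2 [OF sums_zero, of "1 / rho n"] dual_charlier_orthogonal [of n n] rho_pos [of n]
      by simp
  qed
  show "wl2_inner (weight a q) (basis_fun i) (basis_fun j) = 0" if "i \<noteq> j" for i j
  proof -
    have "(\<lambda>m. complex_of_real (weight a q m * (dual_charlier_sum i a q m * dual_charlier_sum j a q m))) sums of_real 0"
      using dual_charlier_orthogonal [of i j] that by (intro sums_of_real) simp
    then show ?thesis
      by (simp add: wl2_inner_def basis_fun_def sums_iff mult.assoc)
  qed
  show "\<exists>g\<in>lin_combs basis_fun. wl2_norm (weight a q) (\<lambda>m. f m - g m) < \<epsilon>"
    if f: "f \<in> wl2 (weight a q)" and "\<epsilon> > 0" for f and \<epsilon> :: real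
  proof -
    obtain g where g: "g \<in> lin_combs basis_fun" "wl2_sq (weight a q) (\<lambda>m. f m - g m) < \<epsilon>\<^sup>2"
      using basis_fun_dense [OF f, of "\<epsilon>\<^sup>2"] \<open>\<epsilon> > 0\<close> by auto
    have "(\<lambda>m. f m - g m) \<in> wl2 (weight a q)"
      using lin_combs_basis_fun_subset g(1)
      by (intro wl2_diff_in [OF weight_nonneg f]) blast
    then have "wl2_norm (weight a q) (\<lambda>m. f m - g m) < \<epsilon>"
      using g(2) \<open>\<epsilon> > 0\<close> by (simp add: wl2_norm_eq real_less_lsqrt)
    then show ?thesis using g(1) by blast
  qed
qed

section \<open>Polynomials as functions on the line and their integrals\<close>

definition poly_fun :: "nat \<Rightarrow> real \<Rightarrow> complex" where
  "poly_fun n x = of_real (poly (dual_charlier n a q) x)"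

lemma poly_fun_mu: "poly_fun n (mu a q m) = basis_fun n m"
  by (simp add: poly_fun_def basis_fun_def poly_dual_charlier_mu)

text \<open>One nonzero polynomial of each degree spans all complex polynomials. This links density
  of the \<open>d_n\<close> to the density of polynomials required for extremality.\<close>

lemma lin_combs_poly_fun_eq:
  "lin_combs poly_fun = range (\<lambda>(r :: complex poly) x. poly r (of_real x))"
proof (intro subset_antisym subsetI)
  fix f assume "f \<in> lin_combs poly_fun"
  then obtain N c where "f = (\<lambda>x. \<Sum>n<N. c n * poly_fun n x)"
    unfolding lin_combs_def by blast
  then have "f = (\<lambda>x. poly (\<Sum>n<N. smult (c n) (map_poly of_real (dual_charlier n a q))) (of_real x))"
    by (simp add: poly_sum poly_of_real_map_poly poly_fun_def)
  then show "f \<in> range (\<lambda>(r :: complex poly) x. poly r (of_real x))" by blast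
next
  fix f assume "f \<in> range (\<lambda>(r :: complex poly) x. poly r (of_real x))"
  then obtain r :: "complex poly" where r: "f = (\<lambda>x. poly r (of_real x))" by blast
  obtain N c where "r = (\<Sum>n<N. smult (c n) (map_poly of_real (dual_charlier n a q)))"
    using poly_span_of_degrees [of "\<lambda>n. map_poly of_real (dual_charlier n a q)" r]
      degree_dual_charlier [OF q_pos q_less_1 a_pos] dual_charlier_nonzero
    by (auto simp: degree_map_poly map_poly_eq_0_iff)
  then have "f = (\<lambda>x. \<Sum>n<N. c n * poly_fun n x)"
    by (simp add: r poly_sum poly_of_real_map_poly poly_fun_def)
  then show "f \<in> lin_combs poly_fun" by (simp only: lin_combsI)
qed

lemma lin_combs_poly_fun_mu:
  "(\<lambda>f m. f (mu a q m)) ` lin_combs poly_fun = lin_combs basis_fun"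
  unfolding lin_combs_def by (force simp: poly_fun_mu image_iff)

text \<open>Every polynomial is a combination of the \<open>d_n\<close>, so square-summability is
  inherited from the basis functions.\<close>

lemma poly_mu_wl2: "(\<lambda>m. of_real (poly p (mu a q m))) \<in> wl2 (weight a q)"
proof -
  have "(\<lambda>x. poly (map_poly of_real p) (of_real x :: complex)) \<in> lin_combs poly_fun"
    unfolding lin_combs_poly_fun_eq by blast
  from imageI [OF this, of "\<lambda>f m. f (mu a q m)"]
  have "(\<lambda>m. poly (map_poly of_real p) (of_real (mu a q m) :: complex)) \<in> lin_combs basis_fun"
    by (simp only: lin_combs_poly_fun_mu)
  then show ?thesis
    using lin_combs_basis_fun_subset
    by (auto simp: poly_of_real_map_poly)
qed

text \<open>The inequality \<open>\<bar>x\<bar> \<le> 1 + x\<^sup>2\<close> bounds the series by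
  those for the squares of \<open>1\<close> and \<open>p\<close>.\<close>

lemma summable_weight_poly: "summable (\<lambda>m. weight a q m * \<bar>poly p (mu a q m)\<bar>)"
proof -
  have sq: "summable (\<lambda>m. weight a q m * (poly p (mu a q m))\<^sup>2)" for p
    using poly_mu_wl2 [of p] by (simp add: wl2_def)
  have "summable (\<lambda>m. weight a q m * (poly 1 (mu a q m))\<^sup>2 + weight a q m * (poly p (mu a q m))\<^sup>2)"
    by (intro summable_add sq)
  then show ?thesis
  proof (rule summable_comparison_test' [where N = 0])
    fix m
    have "\<bar>x\<bar> \<le> 1 + x\<^sup>2" for x :: real
      using zero_le_power2 [of "\<bar>x\<bar> - 1"] zero_le_power2 [of x] by (simp add: power2_diff)
    from mult_left_mono [OF this weight_nonneg, of m "poly p (mu a q m)"]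
    show "norm (weight a q m * \<bar>poly p (mu a q m)\<bar>)
        \<le> weight a q m * (poly 1 (mu a q m))\<^sup>2 + weight a q m * (poly p (mu a q m))\<^sup>2"
      using weight_nonneg by (simp add: abs_mult algebra_simps)
  qed
qed

text \<open>Integrals are pulled back along \<open>mu a q\<close> to the index set, where the weight
  becomes a factor under counting measure and integrability is absolute summability.\<close>

lemma integral_point_mass:
  fixes f :: "real \<Rightarrow> real"
  assumes f: "f \<in> borel_measurable borel"
  shows integrable_point_mass_iff:
      "integrable (point_mass_measure a q) f \<longleftrightarrow> summable (\<lambda>m. weight a q m * \<bar>f (mu a q m)\<bar>)"
    and integral_point_mass_eq:
      "summable (\<lambda>m. weight a q m * \<bar>f (mu a q m)\<bar>) \<Longrightarrow>
         (\<integral>x. f x \<partial>point_mass_measure a q) = (\<Sum>m. weight a q m * f (mu a q m))"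
proof -
  let ?P = "point_measure UNIV (\<lambda>m. ennreal (weight a q m))"
  have mu: "mu a q \<in> measurable ?P borel"
    by (simp add: point_measure_def)
  have 1: "integrable ?P (\<lambda>m. f (mu a q m))
      \<longleftrightarrow> integrable (count_space UNIV) (\<lambda>m. weight a q m *\<^sub>R f (mu a q m))"
    unfolding point_measure_def using weight_nonneg by (intro integrable_density) auto
  show iff: "integrable (point_mass_measure a q) f \<longleftrightarrow> summable (\<lambda>m. weight a q m * \<bar>f (mu a q m)\<bar>)"
    unfolding point_mass_measure_def integrable_distr_eq [OF mu f] 1 integrable_count_space_nat_iff
    using weight_nonneg by (simp add: abs_mult)
  assume "summable (\<lambda>m. weight a q m * \<bar>f (mu a q m)\<bar>)"
  then have int: "integrable (count_space UNIV) (\<lambda>m. weight a q m *\<^sub>R f (mu a q m))"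
    unfolding integrable_count_space_nat_iff using weight_nonneg by (simp add: abs_mult)
  have "(\<integral>x. f x \<partial>point_mass_measure a q) = (\<integral>m. f (mu a q m) \<partial>?P)"
    unfolding point_mass_measure_def by (rule integral_distr [OF mu f])
  also have "\<dots> = (\<integral>m. weight a q m *\<^sub>R f (mu a q m) \<partial>count_space UNIV)"
    unfolding point_measure_def using weight_nonneg by (intro integral_density) auto
  also have "\<dots> = (\<Sum>m. weight a q m * f (mu a q m))"
    using integral_count_space_nat [OF int] by simp
  finally show "(\<integral>x. f x \<partial>point_mass_measure a q) = (\<Sum>m. weight a q m * f (mu a q m))" .
qed

section \<open>The L2 space of the point measure and extremality\<close>

lemma sets_point_mass: "sets (point_mass_measure a q) = sets borel"
  by (simp add: point_mass_measure_def)

lemma borel_measurable_point_mass: "borel_measurable (point_mass_measure a q) = borel_measurable borel"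
  by (rule measurable_cong_sets) (simp_all add: sets_point_mass)

text \<open>Restriction to the points \<open>mu a q m\<close> relates this L2 space to the weighted
  sequence space, which is how density is carried over.\<close>

lemma L2_space_point_mass_iff:
  "f \<in> L2_space (point_mass_measure a q) \<longleftrightarrow>
     f \<in> borel_measurable borel \<and> (\<lambda>m. f (mu a q m)) \<in> wl2 (weight a q)"
proof (cases "f \<in> borel_measurable borel")
  case True
  then have "(\<lambda>x. (cmod (f x))\<^sup>2) \<in> borel_measurable borel" by measurable
  from integrable_point_mass_iff [OF this] True show ?thesis
    by (simp add: L2_space_def borel_measurable_point_mass wl2_def)
qed (simp add: L2_space_def borel_measurable_point_mass)

lemma lin_combs_poly_fun_measurable:
  assumes "f \<in> lin_combs poly_fun"
  shows "f \<in> borel_measurable borel"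
proof -
  obtain r :: "complex poly" where "f = (\<lambda>x. poly r (of_real x))"
    using assms unfolding lin_combs_poly_fun_eq by blast
  then show ?thesis
    by (auto intro!: borel_measurable_continuous_onI continuous_intros)
qed

text \<open>An approximant in the sequence space is the restriction of a combination of polynomial
  functions, and the integral of the squared error equals the corresponding series.\<close>

lemma L2_dense_poly_fun: "L2_dense (point_mass_measure a q) (lin_combs poly_fun)"
  unfolding L2_dense_def
proof (intro conjI ballI allI impI subsetI)
  have wl2: "(\<lambda>m. g (mu a q m)) \<in> wl2 (weight a q)" if "g \<in> lin_combs poly_fun" for g
    using that lin_combs_poly_fun_mu lin_combs_basis_fun_subset by blast
  show "g \<in> L2_space (point_mass_measure a q)" if "g \<in> lin_combs poly_fun" for g
    unfolding L2_space_point_mass_iff using that wl2 lin_combs_poly_fun_measurable by blast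
  fix f and \<epsilon> :: real
  assume "f \<in> L2_space (point_mass_measure a q)" and "\<epsilon> > 0"
  then have f: "f \<in> borel_measurable borel" "(\<lambda>m. f (mu a q m)) \<in> wl2 (weight a q)"
    by (simp_all add: L2_space_point_mass_iff)
  obtain h where h: "h \<in> lin_combs basis_fun" "wl2_sq (weight a q) (\<lambda>m. f (mu a q m) - h m) < \<epsilon>\<^sup>2"
    using basis_fun_dense [OF f(2), of "\<epsilon>\<^sup>2"] \<open>\<epsilon> > 0\<close> by auto
  then obtain g where g: "g \<in> lin_combs poly_fun" "h = (\<lambda>m. g (mu a q m))"
    unfolding lin_combs_poly_fun_mu [symmetric] by blast
  have [measurable]: "g \<in> borel_measurable borel" "f \<in> borel_measurable borel"
    using g f lin_combs_poly_fun_measurable by auto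
  have "(\<integral>x. (cmod (f x - g x))\<^sup>2 \<partial>point_mass_measure a q) = wl2_sq (weight a q) (\<lambda>m. f (mu a q m) - h m)"
    unfolding wl2_sq_def g(2)
    using wl2_diff_in [OF weight_nonneg f(2) wl2 [OF g(1)]]
    by (intro integral_point_mass_eq) (simp_all add: wl2_def)
  then have "sqrt (\<integral>x. (cmod (f x - g x))\<^sup>2 \<partial>point_mass_measure a q) < \<epsilon>"
    using h(2) \<open>\<epsilon> > 0\<close> by (simp add: real_less_lsqrt)
  then show "\<exists>g\<in>lin_combs poly_fun. sqrt (\<integral>x. (cmod (f x - g x))\<^sup>2 \<partial>point_mass_measure a q) < \<epsilon>"
    using g(1) by blast
qed

lemma integrable_poly: "integrable (point_mass_measure a q) (poly p)"
  using summable_weight_poly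
  by (subst integrable_point_mass_iff) (auto intro!: borel_measurable_continuous_onI continuous_intros)

lemma integral_poly: "(\<integral>x. poly p x \<partial>point_mass_measure a q) = (\<Sum>m. weight a q m * poly p (mu a q m))"
  using summable_weight_poly
  by (intro integral_point_mass_eq) (auto intro!: borel_measurable_continuous_onI continuous_intros)

lemma orthogonality_measure_point_mass:
  "orthogonality_measure (point_mass_measure a q) (\<lambda>n. dual_charlier n a q)"
proof -
  have int: "(\<integral>x. poly (dual_charlier i a q) x * poly (dual_charlier j a q) x \<partial>point_mass_measure a q)
      = (if i = j then 1 / rho i else 0)" for i j
    using integral_poly [of "dual_charlier i a q * dual_charlier j a q"]
      sums_unique [OF dual_charlier_orthogonal [of i j]]
    by (simp add: poly_dual_charlier_mu)
  show ?thesis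
    unfolding orthogonality_measure_def
  proof (intro conjI allI impI)
    show "integrable (point_mass_measure a q) (\<lambda>x. x ^ k)" for k
      using integrable_poly [of "monom 1 k"] by (simp add: poly_monom [abs_def])
  qed (use int rho_pos in \<open>simp_all add: sets_point_mass power2_eq_square\<close>)
qed

end

theorem mainTheorem2:
  fixes a q :: real
  assumes "0 < q" and "q < 1" and "0 < a"
  shows "orthogonal_basis (weight a q) (\<lambda>n m. of_real (poly (dual_charlier n a q) (mu a q m)))
    \<and> L2_dense (point_mass_measure a q) (lin_combs (\<lambda>n x. of_real (poly (dual_charlier n a q) x)))
    \<and> extremal_orthogonality_measure (point_mass_measure a q) (\<lambda>n. dual_charlier n a q)"
proof -
  interpret dual_alternative_charlier a q
    using assms by unfold_locales
  have "orthogonal_basis (weight a q) (\<lambda>n m. of_real (poly (dual_charlier n a q) (mu a q m)))"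
    using orthogonal_basis_basis_fun by (simp add: basis_fun_def [abs_def] poly_dual_charlier_mu)
  moreover have "L2_dense (point_mass_measure a q) (lin_combs (\<lambda>n x. of_real (poly (dual_charlier n a q) x)))"
    using L2_dense_poly_fun by (simp add: poly_fun_def [abs_def])
  moreover have "extremal_orthogonality_measure (point_mass_measure a q) (\<lambda>n. dual_charlier n a q)"
    unfolding extremal_orthogonality_measure_def
    using orthogonality_measure_point_mass L2_dense_poly_fun lin_combs_poly_fun_eq by simp
  ultimately show ?thesis by blast
qed

end
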